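(* Let $(M,\mathcal B,\mu,\Phi_t)$ be a system with pure point spectrum, $C^\infty$ Koopman eigenfunctions and $m$ basic frequencies as described in the context, let $F:M\to\mathbb R^d$ be a smooth embedding with induced metric $g$, and let $\bar g=\sum_{i,j=1}^mB_{ij}\,\beta_i\otimes\beta_j$ be the metric defined in the context. The Laplace-Beltrami operator $\Delta_{\bar g}:C^\infty(M)\to C^\infty(M)$ associated with $\bar g$ is $$\Delta_{\bar g}=-\sum_{i,j=1}^mB^{-1}_{ij}\,v_i\circ v_j,$$ where $B^{-1}_{ij}$ are the elements of the inverse of the matrix $[B_{ij}]$.
   Context: Setting. $M$ is a closed, connected, compact, orientable $C^\infty$ manifold of dimension $m$ with Borel $\sigma$-algebra $\mathcal B$; $\Phi_t:M\to M$, $t\in\mathbb R$, is a smooth flow with generating smooth vector field $v$; $\mu$ is a $\Phi_t$-invariant Borel probability measure with smooth positive density in local coordinates, ergodic for the discrete-time system $\hat\Phi_n=\Phi_{nT}$, $n\in\mathbb Z$ ($T>0$ fixed). $\tilde v$ is the skew-adjoint generator of the Koopman group $U_tf=f\circ\Phi_t$ on $L^2(M,\mu)$. Pure point spectrum. There are rationally independent real numbers $\Omega_1,\dots,\Omega_m$ and $C^\infty$ eigenfunctions $\zeta_i$ with $\tilde v(\zeta_i)=\mathrm i\,\Omega_i\zeta_i$, $|\zeta_i|=1$, such that $z_k=\prod_{i=1}^m\zeta_i^{k_i}$, $k\in\mathbb Z^m$, form an orthonormal basis of $L^2(M,\mu)$. The map $(\zeta_1,\dots,\zeta_m):M\to\mathbb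 T^m$ is a $C^\infty$ diffeomorphism, giving angle coordinates $\theta^i$ with $\zeta_i=e^{\mathrm i\theta^i}$; set $v_i=\Omega_i\frac{\partial}{\partial\theta^i}$, globally defined smooth vector fields, viewed as first-order differential operators on $C^\infty(M)$. Metric. $g(u_1,u_2)=F_*u_1\cdot F_*u_2$; $B_{ij}=\int_Mg(v_i,v_j)\,d\mu$; $\beta_i$ are the smooth 1-forms with $\beta_i(v_j)=\delta_{ij}$; $\bar g=\sum_{i,j}B_{ij}\beta_i\otimes\beta_j$ (this is the limit as $s\to\infty$ of the metrics $g_s(u_1,u_2)=\frac1s\sum_{k=0}^{s-1}g(\hat\Phi_{-k*}u_1,\hat\Phi_{-k*}u_2)$). Sign convention: $\Delta_{\bar g}=-\mathrm{div}_{\bar g}\,\mathrm{grad}_{\bar g}$ (nonnegative). *)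

theory Defs
  imports "HOL-Probability.Probability"
begin

section \<open>Smooth maps between open subsets of Euclidean spaces\<close>

primrec C_k_on :: "nat \<Rightarrow> 'b::euclidean_space set \<Rightarrow> ('b \<Rightarrow> 'c::euclidean_space) \<Rightarrow> bool" where
  "C_k_on 0 S f \<longleftrightarrow> continuous_on S f"
| "C_k_on (Suc k) S f \<longleftrightarrow> (\<forall>x\<in>S. f differentiable (at x)) \<and>
     (\<forall>v. C_k_on k S (\<lambda>x. frechet_derivative f (at x) v))"

text \<open>The definition is only meaningful for open \<open>S\<close>, and only used for such sets.\<close>

definition smooth_on :: "'b::euclidean_space set \<Rightarrow> ('b \<Rightarrow> 'c::euclidean_space) \<Rightarrow> bool" where
  "smooth_on S f \<longleftrightarrow> (\<forall>k. C_k_on k S f)"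


section \<open>Smooth manifolds\<close>

text \<open>A chart is a pair of a coordinate domain and a coordinate map; the values of the coordinate
  map outside of the domain are irrelevant. A manifold is a subset \<open>M\<close> of a topological space,
  with the subspace topology, together with a (not necessarily maximal) atlas.\<close>

type_synonym ('a, 'b) chart = "'a set \<times> ('a \<Rightarrow> 'b)"

abbreviation chart_dom :: "('a, 'b) chart \<Rightarrow> 'a set" where
  "chart_dom c \<equiv> fst c"

abbreviation chart_map :: "('a, 'b) chart \<Rightarrow> 'a \<Rightarrow> 'b" where
  "chart_map c \<equiv> snd c"

definition chart_inv :: "('a, 'b) chart \<Rightarrow> 'b \<Rightarrow> 'a" where
  "chart_inv c = inv_into (chart_dom c) (chart_map c)"

definition is_chart :: "'a::topological_space set \<Rightarrow> ('a, 'b::euclidean_space) chart \<Rightarrow> bool" where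
  "is_chart M c \<longleftrightarrow> openin (top_of_set M) (chart_dom c) \<and> open (chart_map c ` chart_dom c) \<and>
     homeomorphism (chart_dom c) (chart_map c ` chart_dom c) (chart_map c) (chart_inv c)"

definition smooth_atlas :: "'a::topological_space set \<Rightarrow> ('a, 'b::euclidean_space) chart set \<Rightarrow> bool" where
  "smooth_atlas M A \<longleftrightarrow> (\<forall>c\<in>A. is_chart M c) \<and> (\<Union>c\<in>A. chart_dom c) = M \<and>
     (\<forall>c\<in>A. \<forall>c'\<in>A. smooth_on (chart_map c ` (chart_dom c \<inter> chart_dom c')) (chart_map c' \<circ> chart_inv c))"

definition smooth_manifold :: "'a::topological_space set \<Rightarrow> ('a, 'b::euclidean_space) chart set \<Rightarrow> bool" where
  "smooth_manifold M A \<longleftrightarrow> Hausdorff_space (top_of_set M) \<and> second_countable (top_of_set M) \<and>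
     smooth_atlas M A"

definition orientable :: "'a::topological_space set \<Rightarrow> ('a, real^'m) chart set \<Rightarrow> bool" where
  "orientable M A \<longleftrightarrow> (\<exists>A'. smooth_atlas M A' \<and> smooth_atlas M (A \<union> A') \<and>
     (\<forall>c\<in>A'. \<forall>c'\<in>A'. \<forall>p\<in>chart_dom c \<inter> chart_dom c'.
        det (matrix (frechet_derivative (chart_map c' \<circ> chart_inv c) (at (chart_map c p)))) > 0))"

definition smooth_map ::
  "'a::topological_space set \<Rightarrow> ('a, 'b::euclidean_space) chart set \<Rightarrow>
   'c::topological_space set \<Rightarrow> ('c, 'd::euclidean_space) chart set \<Rightarrow> ('a \<Rightarrow> 'c) \<Rightarrow> bool" where
  "smooth_map M A N B f \<longleftrightarrow> f ` M \<subseteq> N \<and> continuous_on M f \<and>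
     (\<forall>c\<in>A. \<forall>c'\<in>B. smooth_on (chart_map c ` (chart_dom c \<inter> f -` chart_dom c'))
                                (chart_map c' \<circ> f \<circ> chart_inv c))"

definition diffeomorphism ::
  "'a::topological_space set \<Rightarrow> ('a, 'b::euclidean_space) chart set \<Rightarrow>
   'c::topological_space set \<Rightarrow> ('c, 'd::euclidean_space) chart set \<Rightarrow> ('a \<Rightarrow> 'c) \<Rightarrow> bool" where
  "diffeomorphism M A N B f \<longleftrightarrow> bij_betw f M N \<and> smooth_map M A N B f \<and>
     smooth_map N B M A (inv_into M f)"

definition euclidean_atlas :: "('b::euclidean_space, 'b) chart set" where
  "euclidean_atlas = {(UNIV, \<lambda>x. x)}"

definition smooth_fun ::
  "'a::topological_space set \<Rightarrow> ('a, 'b::euclidean_space) chart set \<Rightarrow> ('a \<Rightarrow> 'c::euclidean_space) \<Rightarrow> bool" where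
  "smooth_fun M A f \<longleftrightarrow> smooth_map M A UNIV euclidean_atlas f"

definition product_atlas :: "('a, 'b) chart set \<Rightarrow> ('c, 'd) chart set \<Rightarrow> ('a \<times> 'c, 'b \<times> 'd) chart set" where
  "product_atlas A B =
     {(chart_dom c \<times> chart_dom c', map_prod (chart_map c) (chart_map c')) | c c'. c \<in> A \<and> c' \<in> B}"


section \<open>The torus\<close>

definition torus :: "(complex^'m) set" where
  "torus = {w. \<forall>i. norm (w $ i) = 1}"

definition torus_exp :: "real^'m \<Rightarrow> complex^'m" where
  "torus_exp \<theta> = (\<chi> i. cis (\<theta> $ i))"

text \<open>The charts are the branches of the angle coordinates on the open cubes of side \<open>2\<pi>\<close>.\<close>

definition torus_atlas :: "(complex^'m, real^'m) chart set" where
  "torus_atlas = range (\<lambda>a. let Q = {\<theta>. \<forall>i. \<bar>\<theta> $ i - a $ i\<bar> < pi}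
                           in (torus_exp ` Q, inv_into Q torus_exp))"


section \<open>Tangent vectors and vector fields\<close>

text \<open>A tangent vector at \<open>p\<close> assigns to every chart around \<open>p\<close> a component vector, such that the
  component vectors transform by the derivative of the change of charts. It is set to 0 on all
  other arguments, so that equal tangent vectors are equal functions.\<close>

type_synonym ('a, 'b) tvec = "('a, 'b) chart \<Rightarrow> 'b"

definition charts_at :: "('a, 'b) chart set \<Rightarrow> 'a \<Rightarrow> ('a, 'b) chart set" where
  "charts_at A p = {c \<in> A. p \<in> chart_dom c}"

definition chart_at :: "('a, 'b) chart set \<Rightarrow> 'a \<Rightarrow> ('a, 'b) chart" where
  "chart_at A p = (SOME c. c \<in> charts_at A p)"

definition tangent_space :: "('a, 'b::euclidean_space) chart set \<Rightarrow> 'a \<Rightarrow> ('a, 'b) tvec set" where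
  "tangent_space A p = {\<xi>. (\<forall>c. c \<notin> charts_at A p \<longrightarrow> \<xi> c = 0) \<and>
     (\<forall>c\<in>charts_at A p. \<forall>c'\<in>charts_at A p.
        \<xi> c' = frechet_derivative (chart_map c' \<circ> chart_inv c) (at (chart_map c p)) (\<xi> c))}"

text \<open>The tangent vector at \<open>p\<close> whose component vector in the chart \<open>c\<close> is \<open>b\<close>.\<close>

definition chart_vec ::
  "('a, 'b::euclidean_space) chart set \<Rightarrow> ('a, 'b) chart \<Rightarrow> 'a \<Rightarrow> 'b \<Rightarrow> ('a, 'b) tvec" where
  "chart_vec A c p b = (\<lambda>c'. if c' \<in> charts_at A p
     then frechet_derivative (chart_map c' \<circ> chart_inv c) (at (chart_map c p)) b else 0)"

text \<open>The velocity of the curve \<open>\<gamma>\<close> at time \<open>t\<close>, a tangent vector at \<open>\<gamma> t\<close>.\<close>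

definition velocity :: "('a, 'b::euclidean_space) chart set \<Rightarrow> (real \<Rightarrow> 'a) \<Rightarrow> real \<Rightarrow> ('a, 'b) tvec" where
  "velocity A \<gamma> t = (\<lambda>c. if c \<in> charts_at A (\<gamma> t) then vector_derivative (chart_map c \<circ> \<gamma>) (at t) else 0)"

text \<open>The derivative of the vector-valued function \<open>f\<close> along the tangent vector \<open>\<xi>\<close> at \<open>p\<close>; by the
  chain rule, it does not depend on the choice of the chart around \<open>p\<close>. For \<open>f\<close> with values in a
  Euclidean space, it is also the push-forward of \<open>\<xi>\<close> under \<open>f\<close>.\<close>

definition tderiv ::
  "('a, 'b::euclidean_space) chart set \<Rightarrow> ('a \<Rightarrow> 'c::euclidean_space) \<Rightarrow> 'a \<Rightarrow> ('a, 'b) tvec \<Rightarrow> 'c" where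
  "tderiv A f p \<xi> = (let c = chart_at A p
     in frechet_derivative (f \<circ> chart_inv c) (at (chart_map c p)) (\<xi> c))"

type_synonym ('a, 'b) vfield = "'a \<Rightarrow> ('a, 'b) tvec"

definition smooth_vfield :: "'a set \<Rightarrow> ('a, 'b::euclidean_space) chart set \<Rightarrow> ('a, 'b) vfield \<Rightarrow> bool" where
  "smooth_vfield M A X \<longleftrightarrow> (\<forall>p\<in>M. X p \<in> tangent_space A p) \<and>
     (\<forall>c\<in>A. smooth_on (chart_map c ` chart_dom c) (\<lambda>x. X (chart_inv c x) c))"

definition vfield_apply ::
  "('a, 'b::euclidean_space) chart set \<Rightarrow> ('a, 'b) vfield \<Rightarrow> ('a \<Rightarrow> 'c::euclidean_space) \<Rightarrow> 'a \<Rightarrow> 'c" where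
  "vfield_apply A X f = (\<lambda>p. tderiv A f p (X p))"

definition smooth_one_form ::
  "'a set \<Rightarrow> ('a, 'b::euclidean_space) chart set \<Rightarrow> ('a \<Rightarrow> ('a, 'b) tvec \<Rightarrow> real) \<Rightarrow> bool" where
  "smooth_one_form M A \<beta> \<longleftrightarrow>
     (\<forall>p\<in>M. \<forall>\<xi>\<in>tangent_space A p. \<forall>\<eta>\<in>tangent_space A p. \<forall>a b.
        \<beta> p (\<lambda>c. a *\<^sub>R \<xi> c + b *\<^sub>R \<eta> c) = a * \<beta> p \<xi> + b * \<beta> p \<eta>) \<and>
     (\<forall>c\<in>A. \<forall>b. smooth_on (chart_map c ` chart_dom c)
        (\<lambda>x. \<beta> (chart_inv c x) (chart_vec A c (chart_inv c x) b)))"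

definition smooth_embedding ::
  "'a::topological_space set \<Rightarrow> ('a, 'b::euclidean_space) chart set \<Rightarrow> ('a \<Rightarrow> 'c::euclidean_space) \<Rightarrow> bool" where
  "smooth_embedding M A F \<longleftrightarrow> smooth_fun M A F \<and>
     (\<forall>p\<in>M. inj_on (tderiv A F p) (tangent_space A p)) \<and>
     (\<exists>G. homeomorphism M (F ` M) F G)"

text \<open>The coordinate vector field \<open>\<partial>/\<partial>\<theta>\<^sup>i\<close> of the angle coordinates defined by a diffeomorphism \<open>h\<close> from
  \<open>M\<close> to the torus: its value at \<open>p\<close> is the velocity of the \<open>i\<close>-th coordinate line through \<open>p\<close>.\<close>

definition angle_line :: "'a set \<Rightarrow> ('a \<Rightarrow> complex^'m) \<Rightarrow> 'm \<Rightarrow> 'a \<Rightarrow> real \<Rightarrow> 'a" where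
  "angle_line M h i p s = inv_into M h (\<chi> j. if j = i then cis s * h p $ j else h p $ j)"

definition angle_vfield ::
  "'a set \<Rightarrow> ('a, real^'m) chart set \<Rightarrow> ('a \<Rightarrow> complex^'m) \<Rightarrow> 'm \<Rightarrow> ('a, real^'m) vfield" where
  "angle_vfield M A h i = (\<lambda>p. if p \<in> M then velocity A (angle_line M h i p) 0 else (\<lambda>_. 0))"


section \<open>The Laplace-Beltrami operator\<close>

type_synonym ('a, 'b) metric = "'a \<Rightarrow> ('a, 'b) tvec \<Rightarrow> ('a, 'b) tvec \<Rightarrow> real"

definition induced_metric ::
  "('a, 'b::euclidean_space) chart set \<Rightarrow> ('a \<Rightarrow> 'c::euclidean_space) \<Rightarrow> ('a, 'b) metric" where
  "induced_metric A F p \<xi> \<eta> = tderiv A F p \<xi> \<bullet> tderiv A F p \<eta>"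

definition gradient ::
  "('a, 'b::euclidean_space) chart set \<Rightarrow> ('a, 'b) metric \<Rightarrow> ('a \<Rightarrow> real) \<Rightarrow> ('a, 'b) vfield" where
  "gradient A g f p =
     (THE \<xi>. \<xi> \<in> tangent_space A p \<and> (\<forall>\<eta>\<in>tangent_space A p. g p \<xi> \<eta> = tderiv A f p \<eta>))"

text \<open>The determinant of the metric in the coordinates of the chart \<open>c\<close>.\<close>

definition metric_det ::
  "('a, real^'m) chart set \<Rightarrow> ('a, real^'m) metric \<Rightarrow> ('a, real^'m) chart \<Rightarrow> real^'m \<Rightarrow> real" where
  "metric_det A g c x = det (\<chi> i j. g (chart_inv c x)
     (chart_vec A c (chart_inv c x) (axis i 1)) (chart_vec A c (chart_inv c x) (axis j 1)))"

text \<open>The coordinate expression \<open>|g|\<^sup>-\<^sup>1\<^sup>/\<^sup>2 \<Sum>\<^sub>k \<partial>\<^sub>k (|g|\<^sup>1\<^sup>/\<^sup>2 X\<^sub>k)\<close>, which for Riemannian \<open>g\<close> does not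
  depend on the choice of the chart around \<open>p\<close>.\<close>

definition divergence ::
  "('a, real^'m) chart set \<Rightarrow> ('a, real^'m) metric \<Rightarrow> ('a, real^'m) vfield \<Rightarrow> 'a \<Rightarrow> real" where
  "divergence A g X p = (let c = chart_at A p; x = chart_map c p in
     (\<Sum>k\<in>UNIV. frechet_derivative (\<lambda>y. sqrt (metric_det A g c y) * X (chart_inv c y) c $ k) (at x) (axis k 1))
       / sqrt (metric_det A g c x))"

definition laplace_beltrami ::
  "('a, real^'m) chart set \<Rightarrow> ('a, real^'m) metric \<Rightarrow> ('a \<Rightarrow> real) \<Rightarrow> 'a \<Rightarrow> real" where
  "laplace_beltrami A g f = (\<lambda>p. - divergence A g (gradient A g f) p)"

text \<open>The complex-linear extension to complex-valued functions.\<close>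

definition laplace_beltrami_complex ::
  "('a, real^'m) chart set \<Rightarrow> ('a, real^'m) metric \<Rightarrow> ('a \<Rightarrow> complex) \<Rightarrow> 'a \<Rightarrow> complex" where
  "laplace_beltrami_complex A g f =
     (\<lambda>p. Complex (laplace_beltrami A g (\<lambda>q. Re (f q)) p) (laplace_beltrami A g (\<lambda>q. Im (f q)) p))"


section \<open>Flows, measures and Koopman operators\<close>

definition smooth_flow ::
  "'a::topological_space set \<Rightarrow> ('a, 'b::euclidean_space) chart set \<Rightarrow> (real \<Rightarrow> 'a \<Rightarrow> 'a) \<Rightarrow> bool" where
  "smooth_flow M A \<Phi> \<longleftrightarrow>
     smooth_map (UNIV \<times> M) (product_atlas euclidean_atlas A) M A (\<lambda>(t, p). \<Phi> t p) \<and>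
     (\<forall>p\<in>M. \<Phi> 0 p = p \<and> (\<forall>s t. \<Phi> (s + t) p = \<Phi> s (\<Phi> t p)))"

definition flow_generator ::
  "'a::topological_space set \<Rightarrow> ('a, 'b::euclidean_space) chart set \<Rightarrow> (real \<Rightarrow> 'a \<Rightarrow> 'a) \<Rightarrow> ('a, 'b) vfield \<Rightarrow> bool" where
  "flow_generator M A \<Phi> V \<longleftrightarrow> smooth_vfield M A V \<and>
     (\<forall>p\<in>M. \<forall>t. velocity A (\<lambda>s. \<Phi> s p) t = V (\<Phi> t p))"

definition smooth_positive_density ::
  "'a::topological_space set \<Rightarrow> ('a, 'b::euclidean_space) chart set \<Rightarrow> 'a measure \<Rightarrow> bool" where
  "smooth_positive_density M A \<mu> \<longleftrightarrow> (\<forall>c\<in>A. \<exists>\<rho>::'b \<Rightarrow> real.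
     smooth_on (chart_map c ` chart_dom c) \<rho> \<and> (\<forall>x\<in>chart_map c ` chart_dom c. \<rho> x > 0) \<and>
     (\<forall>S\<in>sets \<mu>. S \<subseteq> chart_dom c \<longrightarrow>
        emeasure \<mu> S = (\<integral>\<^sup>+x\<in>chart_map c ` S. ennreal (\<rho> x) \<partial>lborel)))"

definition flow_invariant :: "'a measure \<Rightarrow> (real \<Rightarrow> 'a \<Rightarrow> 'a) \<Rightarrow> bool" where
  "flow_invariant \<mu> \<Phi> \<longleftrightarrow> (\<forall>t. \<Phi> t \<in> measurable \<mu> \<mu> \<and> distr \<mu> \<mu> (\<Phi> t) = \<mu>)"

definition discrete_time_ergodic :: "'a measure \<Rightarrow> (real \<Rightarrow> 'a \<Rightarrow> 'a) \<Rightarrow> real \<Rightarrow> bool" where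
  "discrete_time_ergodic \<mu> \<Phi> T \<longleftrightarrow>
     (\<forall>S\<in>sets \<mu>. (\<forall>n::int. \<Phi> (of_int n * T) -` S \<inter> space \<mu> = S) \<longrightarrow> measure \<mu> S = 0 \<or> measure \<mu> S = 1)"

definition square_integrable :: "'a measure \<Rightarrow> ('a \<Rightarrow> complex) \<Rightarrow> bool" where
  "square_integrable \<mu> f \<longleftrightarrow> f \<in> borel_measurable \<mu> \<and> integrable \<mu> (\<lambda>x. (norm (f x))\<^sup>2)"

text \<open>\<open>f\<close> is in the domain of the generator of the Koopman group on \<open>L\<^sup>2(\<mu>)\<close>, with image \<open>f'\<close>: the
  difference quotients of \<open>t \<mapsto> f \<circ> \<Phi>\<^sub>t\<close> at \<open>t = 0\<close> converge to \<open>f'\<close> in the norm of \<open>L\<^sup>2(\<mu>)\<close>.\<close>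

definition koopman_generator ::
  "'a measure \<Rightarrow> (real \<Rightarrow> 'a \<Rightarrow> 'a) \<Rightarrow> ('a \<Rightarrow> complex) \<Rightarrow> ('a \<Rightarrow> complex) \<Rightarrow> bool" where
  "koopman_generator \<mu> \<Phi> f f' \<longleftrightarrow> square_integrable \<mu> f \<and> square_integrable \<mu> f' \<and>
     ((\<lambda>t. LINT x|\<mu>. (norm ((f (\<Phi> t x) - f x) / of_real t - f' x))\<^sup>2) \<longlongrightarrow> 0) (at 0)"

definition orthonormal_basis_L2 :: "'a measure \<Rightarrow> ('k \<Rightarrow> 'a \<Rightarrow> complex) \<Rightarrow> bool" where
  "orthonormal_basis_L2 \<mu> z \<longleftrightarrow> (\<forall>k. square_integrable \<mu> (z k)) \<and>
     (\<forall>k l. (LINT x|\<mu>. cnj (z k x) * z l x) = (if k = l then 1 else 0)) \<and>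
     (\<forall>f. square_integrable \<mu> f \<longrightarrow> (\<forall>e>0. \<exists>K a. finite K \<and>
        (LINT x|\<mu>. (norm (f x - (\<Sum>k\<in>K. a k * z k x)))\<^sup>2) < e))"

definition rationally_independent :: "('m::finite \<Rightarrow> real) \<Rightarrow> bool" where
  "rationally_independent \<Omega> \<longleftrightarrow>
     (\<forall>q::'m \<Rightarrow> rat. (\<Sum>i\<in>UNIV. of_rat (q i) * \<Omega> i) = 0 \<longrightarrow> (\<forall>i. q i = 0))"

definition pure_point_spectrum ::
  "'a::topological_space set \<Rightarrow> ('a, real^'m) chart set \<Rightarrow> 'a measure \<Rightarrow> (real \<Rightarrow> 'a \<Rightarrow> 'a) \<Rightarrow>
   ('m \<Rightarrow> real) \<Rightarrow> ('m \<Rightarrow> 'a \<Rightarrow> complex) \<Rightarrow> bool" where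
  "pure_point_spectrum M A \<mu> \<Phi> \<Omega> \<zeta> \<longleftrightarrow> rationally_independent \<Omega> \<and>
     (\<forall>i. smooth_fun M A (\<zeta> i) \<and> (\<forall>p\<in>M. norm (\<zeta> i p) = 1) \<and>
          koopman_generator \<mu> \<Phi> (\<zeta> i) (\<lambda>p. \<i> * of_real (\<Omega> i) * \<zeta> i p)) \<and>
     orthonormal_basis_L2 \<mu> (\<lambda>(k::'m \<Rightarrow> int) p. \<Prod>i\<in>UNIV. \<zeta> i p powi k i) \<and>
     diffeomorphism M A torus torus_atlas (\<lambda>p. \<chi> i. \<zeta> i p)"

end

theory Submission
  imports Defs
begin

text \<open>Near every point, the branches of the angle coordinates divided by the frequencies form a smooth map
  \<open>\<psi>\<close> with \<open>D\<psi> v\<^sub>i = e\<^sub>i\<close>. So \<open>\<beta>\<^sub>i\<close> is the \<open>i\<close>-th component of \<open>D\<psi>\<close>, the Gram matrix of the metric in a chart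
  is \<open>(D\<psi>)\<^sup>T B D\<psi>\<close>, and its volume density is \<open>|det D\<psi>|\<close> up to a constant factor. The Piola identity says that
  the fields \<open>v\<^sub>i\<close> are divergence free for this density, so that the divergence of the gradient
  \<open>\<Sum>\<^sub>i\<^sub>j B\<^sup>-\<^sup>1\<^sub>i\<^sub>j (v\<^sub>j f) v\<^sub>i\<close> is \<open>\<Sum>\<^sub>i\<^sub>j B\<^sup>-\<^sup>1\<^sub>i\<^sub>j v\<^sub>i (v\<^sub>j f)\<close>. The matrix \<open>B\<close> is positive definite because
  \<open>F\<close> is an immersion and the \<open>v\<^sub>i\<close> are linearly independent at every point.\<close>

section \<open>Calculus of smooth maps\<close>

text \<open>\<open>divergence\<close> is computed in one chart of \<open>A\<close>, selected by
  \<open>chart_at\<close>, and the branches \<psi> need not be charts of \<open>A\<close>. Passing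
  to angle coordinates would require that the coordinate divergence be invariant under a change of
  chart. Instead everything stays in the selected chart, with the frame carried along as
  vector-valued functions of its coordinates; the Piola identity is the part of that invariance
  which is needed. No first-order terms remain in the result because in the coordinates \<psi> both
  the metric and the fields are constant: the metric is that of a flat torus. How a branch is
  oriented relative to the chart is not controlled, whence |det D\<psi>| and not det D\<psi>. A
  second obstacle is that \<open>tderiv\<close> evaluates in a chart that may jump with the point. A
  first derivative must therefore be rewritten in a fixed chart before it can be differentiated
  again. Smoothness of the Laplacian of f is read off from the final formula.\<close>

lemma C_k_on_SucD: "C_k_on (Suc k) S f \<Longrightarrow> C_k_on k S f"
proof (induction k arbitrary: f)
  case 0
  then show ?case
    by (metis C_k_on.simps differentiable_at_imp_differentiable_on differentiable_imp_continuous_on)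
next
  case (Suc k)
  then show ?case by (metis C_k_on.simps(2))
qed

lemma C_k_on_subset: "C_k_on k S f \<Longrightarrow> T \<subseteq> S \<Longrightarrow> C_k_on k T f"
  by (induction k arbitrary: f) (auto intro: continuous_on_subset)

lemma frechet_derivative_cong:
  assumes "open S" "x \<in> S" "\<And>y. y \<in> S \<Longrightarrow> f y = g y"
  shows "frechet_derivative f (at x) = frechet_derivative g (at x)"
proof -
  have "(f has_derivative D) (at x) \<longleftrightarrow> (g has_derivative D) (at x)" for D
    using assms by (auto intro: has_derivative_transform_within_open[of _ _ _ _ S])
  then show ?thesis by (simp add: frechet_derivative_def)
qed

lemma differentiable_cong:
  assumes "open S" "x \<in> S" "\<And>y. y \<in> S \<Longrightarrow> f y = g y"
  shows "f differentiable (at x) \<longleftrightarrow> g differentiable (at x)"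
proof -
  have "(f has_derivative D) (at x) \<longleftrightarrow> (g has_derivative D) (at x)" for D
    using assms by (auto intro: has_derivative_transform_within_open[of _ _ _ _ S])
  then show ?thesis by (simp add: differentiable_def)
qed

lemma C_k_on_cong:
  assumes "open S" "\<And>y. y \<in> S \<Longrightarrow> f y = g y"
  shows "C_k_on k S f \<longleftrightarrow> C_k_on k S g"
  using assms(2)
proof (induction k arbitrary: f g)
  case 0
  then show ?case by (auto cong: continuous_on_cong)
next
  case (Suc k)
  have "C_k_on k S (\<lambda>x. frechet_derivative f (at x) v) = C_k_on k S (\<lambda>x. frechet_derivative g (at x) v)" for v
    by (rule Suc.IH) (use Suc.prems assms(1) in \<open>simp add: frechet_derivative_cong[of S _ f g]\<close>)
  then show ?case
    using differentiable_cong[OF assms(1) _ Suc.prems] by simp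
qed

text \<open>Branches of the angle coordinates exist only near a given point, so smoothness on a
  whole chart image is glued from neighbourhoods. This works because the derivatives in
  \<open>C_k_on\<close> are taken \<open>at x\<close>, without reference to the set.\<close>

lemma C_k_on_local:
  assumes "open S" "\<And>x. x \<in> S \<Longrightarrow> \<exists>T. open T \<and> x \<in> T \<and> T \<subseteq> S \<and> C_k_on k T f"
  shows "C_k_on k S f"
  using assms(2)
proof (induction k arbitrary: f)
  case 0
  show ?case unfolding C_k_on.simps continuous_on_eq_continuous_at[OF \<open>open S\<close>]
  proof
    fix x assume "x \<in> S"
    then obtain T where "open T" "x \<in> T" "continuous_on T f"
      using 0 by auto
    then show "isCont f x" by (simp add: continuous_on_eq_continuous_at)
  qed
next
  case (Suc k)
  have "C_k_on k S (\<lambda>x. frechet_derivative f (at x) v)" for v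
  proof (rule Suc.IH)
    fix x assume "x \<in> S"
    then obtain T where "open T" "x \<in> T" "T \<subseteq> S" "C_k_on (Suc k) T f"
      using Suc.prems by blast
    then show "\<exists>T. open T \<and> x \<in> T \<and> T \<subseteq> S \<and> C_k_on k T (\<lambda>x. frechet_derivative f (at x) v)"
      by auto
  qed
  moreover have "f differentiable (at x)" if "x \<in> S" for x
    using Suc.prems[OF that] by auto
  ultimately show ?case by simp
qed

lemma C_k_on_const: "C_k_on k S (\<lambda>x. c)"
  by (induction k arbitrary: c) auto

lemma C_k_on_bounded_linear:
  assumes "open S" "bounded_linear L" "C_k_on k S f"
  shows "C_k_on k S (\<lambda>x. L (f x))"
  using assms(3)
proof (induction k arbitrary: f)
  case 0
  then show ?case using bounded_linear.continuous_on[OF assms(2)] by simp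
next
  case (Suc k)
  have d: "((\<lambda>x. L (f x)) has_derivative (\<lambda>v. L (frechet_derivative f (at x) v))) (at x)" if "x \<in> S" for x
    using Suc.prems that by (auto intro!: bounded_linear.has_derivative[OF assms(2)] simp: frechet_derivative_works[symmetric])
  have "C_k_on k S (\<lambda>x. frechet_derivative (\<lambda>x. L (f x)) (at x) v)" for v
  proof -
    have "C_k_on k S (\<lambda>x. L (frechet_derivative f (at x) v))"
      using Suc.prems by (intro Suc.IH) auto
    then show ?thesis
      by (subst C_k_on_cong[OF assms(1)]) (simp add: frechet_derivative_at[OF d, symmetric])+
  qed
  then show ?case using d by (auto simp: differentiable_def)
qed

lemma C_k_on_add:
  assumes "open S" "C_k_on k S f" "C_k_on k S g"
  shows "C_k_on k S (\<lambda>x. f x + g x)"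
  using assms(2,3)
proof (induction k arbitrary: f g)
  case 0
  then show ?case by (auto intro: continuous_intros)
next
  case (Suc k)
  have d: "((\<lambda>x. f x + g x) has_derivative (\<lambda>v. frechet_derivative f (at x) v + frechet_derivative g (at x) v)) (at x)" if "x \<in> S" for x
    using Suc.prems that by (auto intro!: has_derivative_add simp: frechet_derivative_works[symmetric])
  have "C_k_on k S (\<lambda>x. frechet_derivative (\<lambda>x. f x + g x) (at x) v)" for v
  proof -
    have "C_k_on k S (\<lambda>x. frechet_derivative f (at x) v + frechet_derivative g (at x) v)"
      using Suc.prems by (intro Suc.IH) auto
    then show ?thesis
      by (subst C_k_on_cong[OF assms(1)]) (simp add: frechet_derivative_at[OF d, symmetric])+
  qed
  then show ?case using d by (auto simp: differentiable_def)
qed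

lemma C_k_on_sum:
  assumes "open S" "\<And>i. i \<in> I \<Longrightarrow> C_k_on k S (f i)"
  shows "C_k_on k S (\<lambda>x. \<Sum>i\<in>I. f i x)"
  using assms(2)
  by (induction I rule: infinite_finite_induct) (auto intro: C_k_on_const C_k_on_add[OF assms(1)])

lemma C_k_on_bounded_bilinear:
  assumes "open S" "bounded_bilinear L" "C_k_on k S f" "C_k_on k S g"
  shows "C_k_on k S (\<lambda>x. L (f x) (g x))"
  using assms(3,4)
proof (induction k arbitrary: f g)
  case 0
  then show ?case using bounded_bilinear.continuous_on[OF assms(2)] by auto
next
  case (Suc k)
  have d: "((\<lambda>x. L (f x) (g x)) has_derivative
      (\<lambda>v. L (f x) (frechet_derivative g (at x) v) + L (frechet_derivative f (at x) v) (g x))) (at x)" if "x \<in> S" for x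
    using Suc.prems that by (auto intro!: bounded_bilinear.FDERIV[OF assms(2)] simp: frechet_derivative_works[symmetric])
  have "C_k_on k S (\<lambda>x. frechet_derivative (\<lambda>x. L (f x) (g x)) (at x) v)" for v
  proof -
    have "C_k_on k S (\<lambda>x. L (f x) (frechet_derivative g (at x) v) + L (frechet_derivative f (at x) v) (g x))"
      using Suc.prems by (intro C_k_on_add assms Suc.IH) (auto intro: C_k_on_SucD)
    then show ?thesis
      by (subst C_k_on_cong[OF assms(1)]) (simp add: frechet_derivative_at[OF d, symmetric])+
  qed
  then show ?case using d by (auto simp: differentiable_def)
qed

lemma linear_sum_Basis:
  assumes "linear L"
  shows "L (w::'b::euclidean_space) = (\<Sum>b\<in>Basis. (w \<bullet> b) *\<^sub>R L b)"
  by (metis (no_types, lifting) assms euclidean_representation linear_sum linear_scale sum.cong)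

text \<open>\<open>C_k_on\<close> speaks of fixed directions only. A direction that moves with the
  point is expanded in \<open>Basis\<close>, which leaves products of its coordinates with
  derivatives in fixed directions.\<close>

lemma C_k_on_frechet_derivative:
  assumes "open S" "C_k_on (Suc k) S f" "C_k_on k S w"
  shows "C_k_on k S (\<lambda>x. frechet_derivative f (at x) (w x))"
proof -
  have "C_k_on k S (\<lambda>x. \<Sum>b\<in>Basis. (w x \<bullet> b) *\<^sub>R frechet_derivative f (at x) b)"
    using assms(2)
    by (intro C_k_on_sum assms C_k_on_bounded_bilinear[OF _ bounded_bilinear_scaleR]
        C_k_on_bounded_linear[OF _ bounded_linear_inner_left]) auto
  moreover have "frechet_derivative f (at x) (w x) = (\<Sum>b\<in>Basis. (w x \<bullet> b) *\<^sub>R frechet_derivative f (at x) b)" if "x \<in> S" for x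
    using assms(2) that by (intro linear_sum_Basis linear_frechet_derivative) auto
  ultimately show ?thesis by (subst C_k_on_cong[OF assms(1)]) auto
qed

text \<open>Induction with the chain rule. The outer derivative is applied to a moving vector, so it
  is expanded over \<open>Basis\<close>; the induction hypothesis then applies to the derivatives of
  \<open>g\<close> in fixed directions, composed with the same \<open>f\<close>.\<close>

lemma C_k_on_compose:
  assumes "open S" "open T" "f ` S \<subseteq> T" "C_k_on k S f" "C_k_on k T g"
  shows "C_k_on k S (g \<circ> f)"
  using assms(4,5)
proof (induction k arbitrary: g)
  case 0
  then show ?case using assms(3) by (metis C_k_on.simps(1) continuous_on_compose continuous_on_subset)
next
  case (Suc k)
  have d: "((g \<circ> f) has_derivative (frechet_derivative g (at (f x)) \<circ> frechet_derivative f (at x))) (at x)" if "x \<in> S" for x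
    using Suc.prems that assms(3) by (auto intro!: diff_chain_at simp: frechet_derivative_works[symmetric])
  have "C_k_on k S (\<lambda>x. frechet_derivative (g \<circ> f) (at x) v)" for v
  proof -
    have *: "C_k_on k S (\<lambda>x. \<Sum>b\<in>Basis. (frechet_derivative f (at x) v \<bullet> b) *\<^sub>R ((\<lambda>y. frechet_derivative g (at y) b) \<circ> f) x)"
      using Suc.prems
      by (intro C_k_on_sum assms C_k_on_bounded_bilinear[OF _ bounded_bilinear_scaleR]
          C_k_on_bounded_linear[OF _ bounded_linear_inner_left] Suc.IH) (auto intro: C_k_on_SucD)
    have "frechet_derivative (g \<circ> f) (at x) v = (\<Sum>b\<in>Basis. (frechet_derivative f (at x) v \<bullet> b) *\<^sub>R ((\<lambda>y. frechet_derivative g (at y) b) \<circ> f) x)" if "x \<in> S" for x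
      using linear_sum_Basis[OF linear_frechet_derivative, of g "at (f x)" "frechet_derivative f (at x) v"]
        Suc.prems that assms(3) by (auto simp: frechet_derivative_at[OF d[OF that], symmetric])
    with * show ?thesis by (subst C_k_on_cong[OF assms(1)]) auto
  qed
  then show ?case using d unfolding C_k_on.simps differentiable_def by blast
qed

section \<open>Transfer from finite order to smooth maps\<close>

lemma smooth_on_imp_differentiable: "smooth_on S f \<Longrightarrow> x \<in> S \<Longrightarrow> f differentiable (at x)"
  unfolding smooth_on_def by (metis C_k_on.simps(2))

lemma smooth_on_has_derivative:
  "smooth_on S f \<Longrightarrow> x \<in> S \<Longrightarrow> (f has_derivative frechet_derivative f (at x)) (at x)"
  using smooth_on_imp_differentiable frechet_derivative_works by blast

lemma smooth_on_imp_continuous_on: "smooth_on S f \<Longrightarrow> continuous_on S f"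
  unfolding smooth_on_def by (metis C_k_on.simps(1))

lemma smooth_on_subset: "smooth_on S f \<Longrightarrow> T \<subseteq> S \<Longrightarrow> smooth_on T f"
  unfolding smooth_on_def by (meson C_k_on_subset)

lemma smooth_on_cong:
  assumes "open S" "\<And>y. y \<in> S \<Longrightarrow> f y = g y"
  shows "smooth_on S f \<longleftrightarrow> smooth_on S g"
  unfolding smooth_on_def using C_k_on_cong[OF assms] by simp

lemma smooth_on_local:
  assumes "open S" "\<And>x. x \<in> S \<Longrightarrow> \<exists>T. open T \<and> x \<in> T \<and> T \<subseteq> S \<and> smooth_on T f"
  shows "smooth_on S f"
  using assms unfolding smooth_on_def by (meson C_k_on_local)

lemma smooth_on_compose:
  assumes "open S" "open T" "f ` S \<subseteq> T" "smooth_on S f" "smooth_on T g"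
  shows "smooth_on S (g \<circ> f)"
  using assms unfolding smooth_on_def by (meson C_k_on_compose)

lemma smooth_on_const: "smooth_on S (\<lambda>x. c)"
  by (simp add: smooth_on_def C_k_on_const)

lemma smooth_on_bounded_linear:
  "open S \<Longrightarrow> bounded_linear L \<Longrightarrow> smooth_on S f \<Longrightarrow> smooth_on S (\<lambda>x. L (f x))"
  by (simp add: smooth_on_def C_k_on_bounded_linear)

lemma smooth_on_sum:
  "open S \<Longrightarrow> (\<And>i. i \<in> I \<Longrightarrow> smooth_on S (f i)) \<Longrightarrow> smooth_on S (\<lambda>x. \<Sum>i\<in>I. f i x)"
  by (simp add: smooth_on_def C_k_on_sum)

lemma smooth_on_frechet_derivative:
  "open S \<Longrightarrow> smooth_on S f \<Longrightarrow> smooth_on S w \<Longrightarrow> smooth_on S (\<lambda>x. frechet_derivative f (at x) (w x))"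
  by (simp add: smooth_on_def C_k_on_frechet_derivative del: C_k_on.simps)

section \<open>Second derivatives, determinants and the Piola identity\<close>

text \<open>The mean value theorem twice: along \<open>v\<close> for the difference of
  \<open>f\<close> across \<open>s *\<^sub>R u\<close>, then along \<open>u\<close> for the
  derivative of \<open>f\<close> in direction \<open>v\<close>. Only the order of differentiation
  depends on this choice, not the second difference.\<close>

lemma second_difference_mean_value:
  fixes f :: "'b::euclidean_space \<Rightarrow> real"
  assumes "C_k_on 2 S f" "0 < s"
    and sub: "\<And>a b. 0 \<le> a \<Longrightarrow> a \<le> s \<Longrightarrow> 0 \<le> b \<Longrightarrow> b \<le> s \<Longrightarrow> x + a *\<^sub>R u + b *\<^sub>R v \<in> S"
  shows "\<exists>a b. 0 < a \<and> a < s \<and> 0 < b \<and> b < s \<and>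
    f (x + s *\<^sub>R u + s *\<^sub>R v) - f (x + s *\<^sub>R u) - f (x + s *\<^sub>R v) + f x
      = s\<^sup>2 * frechet_derivative (\<lambda>y. frechet_derivative f (at y) v) (at (x + a *\<^sub>R u + b *\<^sub>R v)) u"
proof -
  define f1 where "f1 y = frechet_derivative f (at y)" for y
  define f2 where "f2 y = frechet_derivative (\<lambda>y. f1 y v) (at y)" for y
  have d1: "(f has_derivative f1 y) (at y)" if "y \<in> S" for y
    using assms(1) that by (auto simp: numeral_2_eq_2 f1_def frechet_derivative_works[symmetric])
  have d2: "((\<lambda>y. f1 y v) has_derivative f2 y) (at y)" if "y \<in> S" for y
    using assms(1) that by (auto simp: numeral_2_eq_2 f2_def f1_def frechet_derivative_works[symmetric])
  define p where "p t = f (x + s *\<^sub>R u + t *\<^sub>R v) - f (x + t *\<^sub>R v)" for t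
  have "(p has_real_derivative (f1 (x + s *\<^sub>R u + t *\<^sub>R v) v - f1 (x + t *\<^sub>R v) v)) (at t)" if "0 \<le> t" "t \<le> s" for t
  proof -
    have D: "((\<lambda>t. f (z + t *\<^sub>R v)) has_derivative (\<lambda>h. f1 (z + t *\<^sub>R v) (h *\<^sub>R v))) (at t)" if "z + t *\<^sub>R v \<in> S" for z
      by (rule has_derivative_compose[where g = f and f = "\<lambda>t. z + t *\<^sub>R v", OF _ d1[OF that]]) (auto intro!: derivative_eq_intros)
    have "linear (f1 y)" if "y \<in> S" for y
      using d1[OF that] has_derivative_linear by blast
    then have "(p has_derivative (\<lambda>h. h *\<^sub>R f1 (x + s *\<^sub>R u + t *\<^sub>R v) v - h *\<^sub>R f1 (x + t *\<^sub>R v) v)) (at t)"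
      unfolding p_def using sub[of s t] sub[of 0 t] that \<open>0 < s\<close> D[of "x + s *\<^sub>R u"] D[of x]
      by (auto intro!: has_derivative_diff simp: linear_scale)
    moreover have "(\<lambda>h. h *\<^sub>R f1 (x + s *\<^sub>R u + t *\<^sub>R v) v - h *\<^sub>R f1 (x + t *\<^sub>R v) v)
        = (*) (f1 (x + s *\<^sub>R u + t *\<^sub>R v) v - f1 (x + t *\<^sub>R v) v)"
      by (auto simp: algebra_simps)
    ultimately show ?thesis by (simp add: has_field_derivative_def)
  qed
  from MVT2[OF \<open>0 < s\<close> this] obtain b where b: "0 < b" "b < s"
    "p s - p 0 = s * (f1 (x + s *\<^sub>R u + b *\<^sub>R v) v - f1 (x + b *\<^sub>R v) v)"
    by auto
  define q where "q t = f1 (x + t *\<^sub>R u + b *\<^sub>R v) v" for t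
  have "(q has_real_derivative f2 (x + t *\<^sub>R u + b *\<^sub>R v) u) (at t)" if "0 \<le> t" "t \<le> s" for t
  proof -
    have *: "x + t *\<^sub>R u + b *\<^sub>R v \<in> S" using sub b that by simp
    have "(q has_derivative (\<lambda>h. f2 (x + t *\<^sub>R u + b *\<^sub>R v) (h *\<^sub>R u))) (at t)"
      unfolding q_def by (rule has_derivative_compose[where g = "\<lambda>y. f1 y v" and f = "\<lambda>t. x + t *\<^sub>R u + b *\<^sub>R v", OF _ d2[OF *]]) (auto intro!: derivative_eq_intros)
    moreover have "linear (f2 (x + t *\<^sub>R u + b *\<^sub>R v))"
      using d2[OF *] has_derivative_linear by blast
    ultimately show ?thesis by (simp add: has_field_derivative_def linear_scale mult.commute[of _ "f2 _ u"])
  qed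
  from MVT2[OF \<open>0 < s\<close> this] obtain a where a: "0 < a" "a < s"
    "q s - q 0 = s * f2 (x + a *\<^sub>R u + b *\<^sub>R v) u"
    by auto
  have "f (x + s *\<^sub>R u + s *\<^sub>R v) - f (x + s *\<^sub>R u) - f (x + s *\<^sub>R v) + f x = p s - p 0"
    by (simp add: p_def)
  also have "\<dots> = s * (q s - q 0)" unfolding b(3) by (simp add: q_def)
  finally show ?thesis using a b by (auto simp: power2_eq_square f2_def f1_def)
qed

lemma second_difference_tendsto:
  fixes f :: "'b::euclidean_space \<Rightarrow> real"
  assumes "open S" "x \<in> S" "C_k_on 2 S f"
  shows "((\<lambda>s. (f (x + s *\<^sub>R u + s *\<^sub>R v) - f (x + s *\<^sub>R u) - f (x + s *\<^sub>R v) + f x) / s\<^sup>2)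
     \<longlongrightarrow> frechet_derivative (\<lambda>y. frechet_derivative f (at y) v) (at x) u) (at_right 0)"
proof -
  define f2 where "f2 y = frechet_derivative (\<lambda>y. frechet_derivative f (at y) v) (at y) u" for y
  have cont: "isCont f2 x"
    using assms by (auto simp: numeral_2_eq_2 f2_def[abs_def] continuous_on_eq_continuous_at)
  show ?thesis unfolding f2_def[symmetric]
  proof (rule tendstoI)
    fix e :: real assume "e > 0"
    with cont obtain d1 where d1: "d1 > 0" "\<And>y. dist y x < d1 \<Longrightarrow> dist (f2 y) (f2 x) < e"
      unfolding continuous_at_eps_delta by blast
    obtain d2 where d2: "d2 > 0" "ball x d2 \<subseteq> S" using assms(1,2) open_contains_ball by blast
    \<comment> \<open>For sides \<open>s < d\<close> the whole parallelogram stays in the ball where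
      \<open>f2\<close> is close to \<open>f2 x\<close> and in the ball inside \<open>S\<close>. The
      summand 1 keeps the denominator positive when \<open>u\<close> and \<open>v\<close>
      vanish.\<close>
    define d where "d = min d1 d2 / (norm u + norm v + 1)"
    have "d > 0" unfolding d_def using d1(1) d2(1) by (intro divide_pos_pos) (auto intro: add_nonneg_pos)
    have close: "dist (x + a *\<^sub>R u + b *\<^sub>R v) x < min d1 d2" if "0 \<le> a" "a \<le> s" "0 \<le> b" "b \<le> s" "s < d" for a b s
    proof -
      have "dist (x + a *\<^sub>R u + b *\<^sub>R v) x = norm (a *\<^sub>R u + b *\<^sub>R v)" by (simp add: dist_norm add.assoc)
      also have "\<dots> \<le> a * norm u + b * norm v" using norm_triangle_ineq[of "a *\<^sub>R u" "b *\<^sub>R v"] that by simp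
      also have "\<dots> \<le> s * norm u + s * norm v" using that by (intro add_mono mult_right_mono) auto
      also have "\<dots> \<le> s * (norm u + norm v + 1)" using that by (simp add: algebra_simps)
      also have "\<dots> < d * (norm u + norm v + 1)" using that by (intro mult_strict_right_mono) (auto intro: add_nonneg_pos)
      also have "\<dots> = min d1 d2" unfolding d_def
        using add_nonneg_pos[of "norm u + norm v" 1] by simp
      finally show ?thesis .
    qed
    have "dist ((f (x + s *\<^sub>R u + s *\<^sub>R v) - f (x + s *\<^sub>R u) - f (x + s *\<^sub>R v) + f x) / s\<^sup>2) (f2 x) < e"
      if s: "0 < s" "s < d" for s
    proof -
      have "\<exists>a b. 0 < a \<and> a < s \<and> 0 < b \<and> b < s \<and>
        f (x + s *\<^sub>R u + s *\<^sub>R v) - f (x + s *\<^sub>R u) - f (x + s *\<^sub>R v) + f x = s\<^sup>2 * f2 (x + a *\<^sub>R u + b *\<^sub>R v)"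
        unfolding f2_def
        by (rule second_difference_mean_value[OF assms(3) s(1)])
          (use close s d2(2) in \<open>auto simp: dist_commute subset_iff\<close>)
      then obtain a b where ab: "0 < a" "a < s" "0 < b" "b < s"
        "f (x + s *\<^sub>R u + s *\<^sub>R v) - f (x + s *\<^sub>R u) - f (x + s *\<^sub>R v) + f x = s\<^sup>2 * f2 (x + a *\<^sub>R u + b *\<^sub>R v)"
        by blast
      then show ?thesis using close[of a s b] s by (auto intro!: d1(2))
    qed
    then show "\<forall>\<^sub>F s in at_right 0. dist ((f (x + s *\<^sub>R u + s *\<^sub>R v) - f (x + s *\<^sub>R u) - f (x + s *\<^sub>R v) + f x) / s\<^sup>2) (f2 x) < e"
      unfolding eventually_at_right_field using \<open>d > 0\<close> by auto
  qed
qed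

text \<open>Schwarz's theorem: the second difference does not change when \<open>u\<close> and
  \<open>v\<close> are exchanged, so its limit equals both mixed derivatives.\<close>

lemma symmetric_second_derivative_real:
  fixes f :: "'b::euclidean_space \<Rightarrow> real"
  assumes "open S" "x \<in> S" "C_k_on 2 S f"
  shows "frechet_derivative (\<lambda>y. frechet_derivative f (at y) v) (at x) u
    = frechet_derivative (\<lambda>y. frechet_derivative f (at y) u) (at x) v"
proof -
  have "f (x + s *\<^sub>R u + s *\<^sub>R v) - f (x + s *\<^sub>R u) - f (x + s *\<^sub>R v) + f x
      = f (x + s *\<^sub>R v + s *\<^sub>R u) - f (x + s *\<^sub>R v) - f (x + s *\<^sub>R u) + f x" for s
    by (simp add: add.commute add.left_commute)
  from second_difference_tendsto[OF assms, of u v, unfolded this] second_difference_tendsto[OF assms, of v u]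
  show ?thesis by (rule tendsto_unique[OF trivial_limit_at_right_real])
qed

text \<open>In the Leibniz expansion, differentiating the factor of row \<open>i\<close> leaves the
  product of the entries \<open>Q x $ j $ p j\<close> over the other rows. At the identity matrix it
  vanishes unless \<open>p\<close> is the identity, so only the trace of the derivative
  survives.\<close>

lemma has_derivative_det_mat_1:
  fixes Q :: "'b::real_normed_vector \<Rightarrow> real^'n^'n"
  assumes "\<And>i j. ((\<lambda>y. Q y $ i $ j) has_derivative Q' i j) (at x)" "Q x = mat 1"
  shows "((\<lambda>y. det (Q y)) has_derivative (\<lambda>h. \<Sum>i\<in>UNIV. Q' i i h)) (at x)"
proof -
  have *: "(\<Sum>i\<in>UNIV. Q' i (p i) h * (\<Prod>j\<in>UNIV - {i}. Q x $ j $ p j)) = (if p = id then \<Sum>i\<in>UNIV. Q' i i h else 0)"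
    if p: "p permutes UNIV" for p h
  proof (cases "p = id")
    case True
    then show ?thesis by (simp add: assms(2) mat_def)
  next
    case False
    have "(\<Prod>j\<in>UNIV - {i}. Q x $ j $ p j) = 0" for i
    proof -
      \<comment> \<open>A permutation that fixes all points but \<open>i\<close> also fixes
        \<open>i\<close>, by injectivity.\<close>
      have "\<exists>j. j \<noteq> i \<and> p j \<noteq> j"
      proof (rule ccontr)
        assume "\<not> ?thesis"
        then have fix_: "\<And>j. j \<noteq> i \<Longrightarrow> p j = j" by auto
        then have "p i = i" using permutes_inj[OF p] by (metis injD)
        with fix_ have "p j = j" for j by (cases "j = i") auto
        then have "p = id" by (simp add: fun_eq_iff)
        with False show False by simp
      qed
      then obtain j where "j \<noteq> i" "p j \<noteq> j" by blast
      then show ?thesis by (intro prod_zero bexI[of _ j]) (auto simp: assms(2) mat_def)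
    qed
    then have "(\<Sum>i\<in>UNIV. Q' i (p i) h * (\<Prod>j\<in>UNIV - {i}. Q x $ j $ p j)) = 0"
      by (simp only: mult_zero_right sum.neutral_const)
    with False show ?thesis by simp
  qed
  have "((\<lambda>y. det (Q y)) has_derivative
     (\<lambda>h. \<Sum>p | p permutes UNIV. of_int (sign p) * (\<Sum>i\<in>UNIV. Q' i (p i) h * (\<Prod>j\<in>UNIV - {i}. Q x $ j $ p j)))) (at x)"
    unfolding det_def
    by (intro has_derivative_sum has_derivative_mult_right has_derivative_prod assms(1))
  also have "(\<lambda>h. \<Sum>p | p permutes UNIV. of_int (sign p) * (\<Sum>i\<in>UNIV. Q' i (p i) h * (\<Prod>j\<in>UNIV - {i}. Q x $ j $ p j)))
     = (\<lambda>h. \<Sum>p | p permutes (UNIV :: 'n set). if p = id then \<Sum>i\<in>UNIV. Q' i i h else 0)"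
  proof -
    have "of_int (sign p) * (\<Sum>i\<in>UNIV. Q' i (p i) h * (\<Prod>j\<in>UNIV - {i}. Q x $ j $ p j))
      = (if p = id then \<Sum>i\<in>UNIV. Q' i i h else 0)" if "p permutes UNIV" for p h
      unfolding *[OF that] by (simp add: sign_id)
    then show ?thesis by (intro ext sum.cong refl) blast
  qed
  also have "\<dots> = (\<lambda>h. \<Sum>i\<in>UNIV. Q' i i h)"
    by (simp add: sum.delta finite_permutations permutes_id)
  finally show ?thesis .
qed

text \<open>Jacobi's formula, reduced to the derivative at the identity: \<open>N\<close> is the
  inverse of \<open>P x\<close>, so det P(y) = det P(x) det (N P(y)), and N P(y) is the identity at
  y = x.\<close>

lemma has_derivative_det:
  fixes P :: "'b::real_normed_vector \<Rightarrow> real^'n^'n"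
  assumes "\<And>i j. ((\<lambda>y. P y $ i $ j) has_derivative P' i j) (at x)" "N ** P x = mat 1"
  shows "((\<lambda>y. det (P y)) has_derivative (\<lambda>h. det (P x) * (\<Sum>i\<in>UNIV. \<Sum>j\<in>UNIV. N $ i $ j * P' j i h))) (at x)"
proof -
  have PN: "P x ** N = mat 1" using assms(2) by (simp add: matrix_left_right_inverse)
  have *: "det (P x) * det (N ** P y) = det (P y)" for y
    unfolding det_mul[symmetric] matrix_mul_assoc PN matrix_mul_lid ..
  have "((\<lambda>y. det (N ** P y)) has_derivative (\<lambda>h. \<Sum>i\<in>UNIV. (\<Sum>j\<in>UNIV. N $ i $ j * P' j i h))) (at x)"
  proof (rule has_derivative_det_mat_1[where Q' = "\<lambda>i k h. \<Sum>j\<in>UNIV. N $ i $ j * P' j k h"])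
    show "((\<lambda>y. (N ** P y) $ i $ k) has_derivative (\<lambda>h. \<Sum>j\<in>UNIV. N $ i $ j * P' j k h)) (at x)" for i k
      unfolding matrix_matrix_mult_def vec_lambda_beta
      by (intro has_derivative_sum has_derivative_mult_right assms(1))
  qed (rule assms(2))
  from has_derivative_mult_right[OF this, of "det (P x)"] show ?thesis
    unfolding * .
qed

lemma frechet_derivative_bounded_linear:
  assumes "bounded_linear L" "f differentiable (at x)"
  shows "frechet_derivative (\<lambda>y. L (f y)) (at x) = (\<lambda>v. L (frechet_derivative f (at x) v))"
  by (rule frechet_derivative_at[symmetric],
      rule bounded_linear.has_derivative[OF assms(1) assms(2)[THEN frechet_derivative_works[THEN iffD1]]])

text \<open>Reduction to components, since the mean value argument needs real values.\<close>

lemma symmetric_second_derivative: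
  fixes f :: "'b::euclidean_space \<Rightarrow> 'c::euclidean_space"
  assumes "open S" "x \<in> S" "C_k_on 2 S f"
  shows "frechet_derivative (\<lambda>y. frechet_derivative f (at y) v) (at x) u
    = frechet_derivative (\<lambda>y. frechet_derivative f (at y) u) (at x) v"
proof (rule euclidean_eqI)
  fix b :: 'c
  have L: "bounded_linear (\<lambda>z. z \<bullet> b)" by (rule bounded_linear_inner_left)
  have C: "C_k_on 2 S (\<lambda>y. f y \<bullet> b)" by (rule C_k_on_bounded_linear[OF assms(1) L assms(3)])
  have f: "f differentiable (at y)" "(\<lambda>y. frechet_derivative f (at y) v) differentiable (at y)" if "y \<in> S" for y v
    using assms(3) that by (simp_all add: numeral_2_eq_2)
  have *: "frechet_derivative (\<lambda>y. frechet_derivative f (at y) v) (at x) u \<bullet> b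
      = frechet_derivative (\<lambda>y. frechet_derivative (\<lambda>y. f y \<bullet> b) (at y) v) (at x) u" for u v
  proof -
    have "frechet_derivative (\<lambda>y. frechet_derivative (\<lambda>y. f y \<bullet> b) (at y) v) (at x)
        = frechet_derivative (\<lambda>y. frechet_derivative f (at y) v \<bullet> b) (at x)"
    proof (rule frechet_derivative_cong[OF assms(1,2)])
      fix y assume "y \<in> S"
      then show "frechet_derivative (\<lambda>y. f y \<bullet> b) (at y) v = frechet_derivative f (at y) v \<bullet> b"
        using f by (subst frechet_derivative_bounded_linear[OF L]) auto
    qed
    also have "\<dots> = (\<lambda>u. frechet_derivative (\<lambda>y. frechet_derivative f (at y) v) (at x) u \<bullet> b)"
      using f assms(2) by (intro frechet_derivative_bounded_linear[OF L]) auto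
    finally show ?thesis by simp
  qed
  show "frechet_derivative (\<lambda>y. frechet_derivative f (at y) v) (at x) u \<bullet> b
    = frechet_derivative (\<lambda>y. frechet_derivative f (at y) u) (at x) v \<bullet> b"
    unfolding * by (rule symmetric_second_derivative_real[OF assms(1,2) C])
qed

text \<open>The Piola identity: in Jacobi's formula and in the derivative of \<open>D\<psi> E\<^sub>i = e\<^sub>i\<close>, the second
  derivatives of \<open>\<psi>\<close> occur with exchanged indices, so that they cancel by symmetry.\<close>

lemma piola_identity:
  fixes \<psi> :: "real^'n \<Rightarrow> real^'n" and E :: "'n \<Rightarrow> real^'n \<Rightarrow> real^'n"
  assumes "open U" "x \<in> U" "C_k_on 2 U \<psi>"
    and E: "\<And>i. E i differentiable (at x)"
    and \<psi>E: "\<And>i y. y \<in> U \<Longrightarrow> frechet_derivative \<psi> (at y) (E i y) = axis i 1"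
  defines "J \<equiv> \<lambda>y. det (matrix (frechet_derivative \<psi> (at y)))"
  shows "J x \<noteq> 0" "J differentiable (at x)"
    and "(\<Sum>k\<in>UNIV. frechet_derivative J (at x) (axis k 1) * E i x $ k)
      + J x * (\<Sum>k\<in>UNIV. frechet_derivative (E i) (at x) (axis k 1) $ k) = 0"
proof -
  define P where "P y = matrix (frechet_derivative \<psi> (at y))" for y
  \<comment> \<open>The columns of \<open>N\<close> are the fields \<open>E i\<close> at
    \<open>x\<close>, so the hypothesis \<open>\<psi>E\<close> at \<open>x\<close> says that
    \<open>N\<close> is the inverse of \<open>P x\<close>.\<close>
  define N where "N = (\<chi> k i. E i x $ k)"
  define P' where "P' b k h = frechet_derivative (\<lambda>y. frechet_derivative \<psi> (at y) (axis k 1)) (at x) h $ b" for b k h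
  define E' where "E' i = frechet_derivative (E i) (at x)" for i
  have diff: "\<psi> differentiable (at y)" if "y \<in> U" for y
    using assms(3) that by (auto simp: numeral_2_eq_2)
  have diff2: "(\<lambda>y. frechet_derivative \<psi> (at y) v) differentiable (at x)" for v
    using assms(2,3) by (auto simp: numeral_2_eq_2)
  have Pmult: "(\<Sum>k\<in>UNIV. P y $ b $ k * w $ k) = frechet_derivative \<psi> (at y) w $ b" if "y \<in> U" for y b w
  proof -
    have "frechet_derivative \<psi> (at y) w = P y *v w"
      using matrix_vector_mul(2)[OF linear_frechet_derivative[OF diff[OF that]]] by (simp add: P_def fun_eq_iff)
    then show ?thesis by (simp add: matrix_vector_mult_def)
  qed
  have PN: "P x ** N = mat 1"
    by (simp add: matrix_matrix_mult_def N_def Pmult[OF assms(2)] \<psi>E[OF assms(2)] vec_eq_iff mat_def axis_def)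
  then have NP: "N ** P x = mat 1" using matrix_left_right_inverse by blast
  have Pd: "((\<lambda>y. P y $ b $ k) has_derivative P' b k) (at x)" for b k
    unfolding P_def matrix_def P'_def
    using bounded_linear.has_derivative[OF bounded_linear_vec_nth, OF diff2[THEN frechet_derivative_works[THEN iffD1]]]
    by simp
  have Ed: "((\<lambda>y. E i y $ k) has_derivative (\<lambda>h. E' i h $ k)) (at x)" for i k
    unfolding E'_def
    using bounded_linear.has_derivative[OF bounded_linear_vec_nth, OF E[THEN frechet_derivative_works[THEN iffD1]]]
    by simp
  have Jd: "(J has_derivative (\<lambda>h. J x * (\<Sum>i\<in>UNIV. \<Sum>j\<in>UNIV. N $ i $ j * P' j i h))) (at x)"
    unfolding J_def P_def[symmetric] by (intro has_derivative_det Pd NP)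
  have "det (P x) * det N = 1" using PN by (metis det_I det_mul)
  then show "J x \<noteq> 0" by (auto simp: J_def P_def)
  show "J differentiable (at x)" using Jd differentiable_def by blast
  have sym: "P' b k (axis a 1) = P' b a (axis k 1)" for a b k
    unfolding P'_def by (subst symmetric_second_derivative[OF assms(1-3)]) (rule refl)
  \<comment> \<open>On \<open>U\<close> the \<open>b\<close>-th component of D\<psi>(y) E_i(y) is
    constant; this is the product rule for its derivative.\<close>
  have D0: "(\<Sum>k\<in>UNIV. P' b k h * N $ k $ i + P x $ b $ k * E' i h $ k) = 0" for b h
  proof -
    have "((\<lambda>y. \<Sum>k\<in>UNIV. P y $ b $ k * E i y $ k) has_derivative
        (\<lambda>h. \<Sum>k\<in>UNIV. P x $ b $ k * E' i h $ k + P' b k h * E i x $ k)) (at x)"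
      by (intro has_derivative_sum has_derivative_mult Pd Ed)
    moreover have "((\<lambda>y. \<Sum>k\<in>UNIV. P y $ b $ k * E i y $ k) has_derivative (\<lambda>h. 0)) (at x)"
      by (rule has_derivative_transform_within_open[OF has_derivative_const[of "axis i 1 $ b"] assms(1,2)])
        (simp add: Pmult \<psi>E)
    ultimately have "(\<lambda>h. \<Sum>k\<in>UNIV. P x $ b $ k * E' i h $ k + P' b k h * E i x $ k) = (\<lambda>h. 0)"
      by (rule has_derivative_unique)
    then show ?thesis by (simp add: fun_eq_iff N_def add.commute)
  qed
  \<comment> \<open>\<open>?T\<close> is evaluated in two ways. Contracting \<open>D0\<close> with
    \<open>N\<close> turns it into minus the coordinate divergence of \<open>E i\<close>; Jacobi's
    formula, after an exchange of indices in the second derivatives, turns \<open>J x * ?T\<close>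
    into the derivative of \<open>J\<close> along \<open>E i\<close>.\<close>
  let ?T = "\<Sum>a\<in>UNIV. \<Sum>b\<in>UNIV. \<Sum>k\<in>UNIV. N $ a $ b * P' b k (axis a 1) * N $ k $ i"
  have "(\<Sum>a\<in>UNIV. \<Sum>b\<in>UNIV. \<Sum>k\<in>UNIV. N $ a $ b * P x $ b $ k * E' i (axis a 1) $ k)
      = (\<Sum>a\<in>UNIV. \<Sum>k\<in>UNIV. (N ** P x) $ a $ k * E' i (axis a 1) $ k)"
    by (rule sum.cong[OF refl], subst sum.swap, rule sum.cong[OF refl])
      (simp add: matrix_matrix_mult_def sum_distrib_right)
  also have "\<dots> = (\<Sum>a\<in>UNIV. E' i (axis a 1) $ a)"
  proof -
    have "(N ** P x) $ a $ k * z = (if a = k then z else 0)" for a k z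
      by (simp add: NP mat_def)
    then show ?thesis by simp
  qed
  finally have "?T + (\<Sum>a\<in>UNIV. E' i (axis a 1) $ a)
      = (\<Sum>a\<in>UNIV. \<Sum>b\<in>UNIV. N $ a $ b * (\<Sum>k\<in>UNIV. P' b k (axis a 1) * N $ k $ i + P x $ b $ k * E' i (axis a 1) $ k))"
    by (simp only: sum.distrib sum_distrib_left distrib_left mult.assoc)
  then have T: "?T = - (\<Sum>a\<in>UNIV. E' i (axis a 1) $ a)" by (simp add: D0)
  have "(\<Sum>k\<in>UNIV. frechet_derivative J (at x) (axis k 1) * E i x $ k) = J x * ?T"
  proof -
    have "(\<Sum>k\<in>UNIV. frechet_derivative J (at x) (axis k 1) * E i x $ k)
       = J x * (\<Sum>k\<in>UNIV. \<Sum>a\<in>UNIV. \<Sum>b\<in>UNIV. N $ a $ b * P' b a (axis k 1) * N $ k $ i)"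
      unfolding frechet_derivative_at[OF Jd, symmetric]
      by (simp only: sum_distrib_left sum_distrib_right N_def mult.assoc vec_lambda_beta)
    also have "(\<Sum>k\<in>UNIV. \<Sum>a\<in>UNIV. \<Sum>b\<in>UNIV. N $ a $ b * P' b a (axis k 1) * N $ k $ i) = ?T"
      by (subst sum.swap, rule sum.cong[OF refl], subst sum.swap, intro sum.cong refl)
        (subst sym, rule refl)
    finally show ?thesis .
  qed
  then show "(\<Sum>k\<in>UNIV. frechet_derivative J (at x) (axis k 1) * E i x $ k)
      + J x * (\<Sum>k\<in>UNIV. frechet_derivative (E i) (at x) (axis k 1) $ k) = 0"
    unfolding T E'_def by simp
qed

text \<open>By continuity \<open>J\<close> keeps its sign near \<open>x\<close>, so |J| agrees there
  with \<open>J\<close> multiplied by the constant \<open>sgn (J x)\<close>.\<close>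

lemma has_derivative_abs_nonzero:
  fixes J :: "'b::real_normed_vector \<Rightarrow> real"
  assumes "J differentiable (at x)" "J x \<noteq> 0"
  shows "((\<lambda>y. \<bar>J y\<bar>) has_derivative (\<lambda>h. sgn (J x) * frechet_derivative J (at x) h)) (at x)"
proof -
  have "isCont J x" using assms(1) by (rule differentiable_imp_continuous_within)
  then have "((\<lambda>y. J x * J y) \<longlongrightarrow> J x * J x) (at x)"
    by (intro tendsto_mult tendsto_const) (simp add: isCont_def)
  moreover have "0 < J x * J x" using assms(2) by (auto simp: zero_less_mult_iff)
  ultimately have "\<forall>\<^sub>F y in at x. 0 < J x * J y" by (rule order_tendstoD(1))
  then have ev: "\<forall>\<^sub>F y in at x. sgn (J x) * J y = \<bar>J y\<bar>"
    by eventually_elim (auto simp: zero_less_mult_iff)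
  have "((\<lambda>y. sgn (J x) * J y) has_derivative (\<lambda>h. sgn (J x) * frechet_derivative J (at x) h)) (at x)"
    by (rule has_derivative_mult_right[OF assms(1)[THEN frechet_derivative_works[THEN iffD1]]])
  moreover have "sgn (J x) * J x = \<bar>J x\<bar>" by (simp add: sgn_real_def)
  ultimately show ?thesis
    using has_derivative_transform_eventually[OF _ ev _ UNIV_I] by blast
qed

text \<open>The product rule splits the divergence of D w_i E_i into D times the derivative of w_i
  along E_i and w_i times the divergence of D E_i; the Piola identity makes the latter zero. The
  constant \<open>c\<close> will be the square root of det B.\<close>

lemma divergence_adapted_frame:
  fixes \<psi> :: "real^'n \<Rightarrow> real^'n" and E :: "'n \<Rightarrow> real^'n \<Rightarrow> real^'n" and w :: "'n \<Rightarrow> real^'n \<Rightarrow> real"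
  assumes "open U" "x \<in> U" "C_k_on 2 U \<psi>"
    and E: "\<And>i. E i differentiable (at x)"
    and \<psi>E: "\<And>i y. y \<in> U \<Longrightarrow> frechet_derivative \<psi> (at y) (E i y) = axis i 1"
    and w: "\<And>i. w i differentiable (at x)"
    and "c \<noteq> 0"
    and D: "\<And>y. y \<in> U \<Longrightarrow> D y = c * \<bar>det (matrix (frechet_derivative \<psi> (at y)))\<bar>"
    and X: "\<And>y. y \<in> U \<Longrightarrow> X y = (\<Sum>i\<in>UNIV. w i y *\<^sub>R E i y)"
  shows "(\<Sum>k\<in>UNIV. frechet_derivative (\<lambda>y. D y * X y $ k) (at x) (axis k 1)) / D x
    = (\<Sum>i\<in>UNIV. frechet_derivative (w i) (at x) (E i x))"
proof -
  define J where "J = (\<lambda>y. det (matrix (frechet_derivative \<psi> (at y))))"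
  have J: "J x \<noteq> 0" "J differentiable (at x)"
    unfolding J_def using piola_identity[of U x \<psi> E, OF assms(1-3) E \<psi>E] by blast+
  have J3: "(\<Sum>k\<in>UNIV. frechet_derivative J (at x) (axis k 1) * E i x $ k)
      + J x * (\<Sum>k\<in>UNIV. frechet_derivative (E i) (at x) (axis k 1) $ k) = 0" for i
    unfolding J_def using piola_identity(3)[of U x \<psi> E, OF assms(1-3) E \<psi>E] by blast
  define J' where "J' = frechet_derivative J (at x)"
  define E' where "E' i = frechet_derivative (E i) (at x)" for i
  define w' where "w' i = frechet_derivative (w i) (at x)" for i
  have Ed: "((\<lambda>y. E i y $ k) has_derivative (\<lambda>h. E' i h $ k)) (at x)" for i k
    unfolding E'_def
    using bounded_linear.has_derivative[OF bounded_linear_vec_nth, OF E[THEN frechet_derivative_works[THEN iffD1]]]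
    by simp
  have wd: "(w i has_derivative w' i) (at x)" for i
    using w by (simp add: w'_def frechet_derivative_works[symmetric])
  have E0: "(\<Sum>k\<in>UNIV. J' (axis k 1) * E i x $ k) = - (J x * (\<Sum>k\<in>UNIV. E' i (axis k 1) $ k))" for i
    using J3[of i] unfolding J'_def E'_def by linarith
  have "((\<lambda>y. c * \<bar>J y\<bar> * (\<Sum>i\<in>UNIV. w i y * E i y $ k)) has_derivative
      (\<lambda>h. c * \<bar>J x\<bar> * (\<Sum>i\<in>UNIV. w i x * E' i h $ k + w' i h * E i x $ k)
        + c * (sgn (J x) * J' h) * (\<Sum>i\<in>UNIV. w i x * E i x $ k))) (at x)" for k
    unfolding J'_def
    by (intro has_derivative_mult has_derivative_mult_right has_derivative_sum wd Ed has_derivative_abs_nonzero J)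
  then have "((\<lambda>y. D y * X y $ k) has_derivative
      (\<lambda>h. c * \<bar>J x\<bar> * (\<Sum>i\<in>UNIV. w i x * E' i h $ k + w' i h * E i x $ k)
        + c * (sgn (J x) * J' h) * (\<Sum>i\<in>UNIV. w i x * E i x $ k))) (at x)" for k
    by (rule has_derivative_transform_within_open[OF _ assms(1,2)]) (simp add: D X J_def)
  note d = frechet_derivative_at[OF this, symmetric]
  let ?a = "c * \<bar>J x\<bar>"
  have sg: "sgn (J x) * J x = \<bar>J x\<bar>" by (metis abs_sgn mult.commute)
  have "(\<Sum>k\<in>UNIV. frechet_derivative (\<lambda>y. D y * X y $ k) (at x) (axis k 1))
    = (\<Sum>k\<in>UNIV. ?a * (\<Sum>i\<in>UNIV. w i x * E' i (axis k 1) $ k + w' i (axis k 1) * E i x $ k)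
        + c * (sgn (J x) * J' (axis k 1)) * (\<Sum>i\<in>UNIV. w i x * E i x $ k))"
    unfolding d ..
  also have "\<dots> = (\<Sum>k\<in>UNIV. \<Sum>i\<in>UNIV. ?a * (w i x * E' i (axis k 1) $ k) + ?a * (w' i (axis k 1) * E i x $ k)
        + c * sgn (J x) * w i x * (J' (axis k 1) * E i x $ k))"
    by (rule sum.cong[OF refl]) (simp add: sum_distrib_left sum.distrib algebra_simps)
  also have "\<dots> = (\<Sum>i\<in>UNIV. \<Sum>k\<in>UNIV. ?a * (w i x * E' i (axis k 1) $ k) + ?a * (w' i (axis k 1) * E i x $ k)
        + c * sgn (J x) * w i x * (J' (axis k 1) * E i x $ k))"
    by (rule sum.swap)
  also have "\<dots> = (\<Sum>i\<in>UNIV. ?a * (w i x * (\<Sum>k\<in>UNIV. E' i (axis k 1) $ k)) + ?a * (\<Sum>k\<in>UNIV. w' i (axis k 1) * E i x $ k)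
        + c * sgn (J x) * w i x * (\<Sum>k\<in>UNIV. J' (axis k 1) * E i x $ k))"
    by (simp only: sum_distrib_left sum.distrib)
  \<comment> \<open>By \<open>E0\<close> the derivative of the density contributes -c w_i sgn(J) J
    div E_i. Since sgn(J) J = |J|, this cancels the term c |J| w_i div E_i.\<close>
  also have "\<dots> = (\<Sum>i\<in>UNIV. ?a * (\<Sum>k\<in>UNIV. w' i (axis k 1) * E i x $ k))"
    unfolding E0 sg[symmetric] by (rule sum.cong[OF refl]) algebra
  also have "\<dots> = ?a * (\<Sum>i\<in>UNIV. w' i (E i x))"
  proof -
    have "(\<Sum>k\<in>UNIV. w' i (axis k 1) * E i x $ k) = w' i (E i x)" for i
    proof -
      have "linear (w' i)" using wd has_derivative_linear by blast
      then have "w' i (\<Sum>k\<in>UNIV. E i x $ k *\<^sub>R axis k 1) = (\<Sum>k\<in>UNIV. w' i (axis k 1) * E i x $ k)"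
        by (simp add: linear_sum linear_scale mult.commute)
      moreover have "(\<Sum>k\<in>UNIV. E i x $ k *\<^sub>R axis k 1) = E i x"
        using basis_expansion[of "E i x"] by (simp add: scalar_mult_eq_scaleR)
      ultimately show ?thesis by simp
    qed
    then show ?thesis by (simp add: sum_distrib_left)
  qed
  finally have "(\<Sum>k\<in>UNIV. frechet_derivative (\<lambda>y. D y * X y $ k) (at x) (axis k 1))
    = ?a * (\<Sum>i\<in>UNIV. w' i (E i x))" .
  moreover have "D x = ?a" unfolding D[OF assms(2)] J_def ..
  ultimately show ?thesis using \<open>c \<noteq> 0\<close> J(1) by (simp add: w'_def)
qed

section \<open>Charts, tangent vectors and vector fields\<close>

locale atlas =
  fixes M :: "'a::topological_space set" and A :: "('a, 'b::euclidean_space) chart set"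
  assumes smooth_atlas: "smooth_atlas M A"
begin

lemma chart_homeomorphism:
  "c \<in> A \<Longrightarrow> homeomorphism (chart_dom c) (chart_map c ` chart_dom c) (chart_map c) (chart_inv c)"
  using smooth_atlas by (auto simp: smooth_atlas_def is_chart_def)

lemma open_chart_image: "c \<in> A \<Longrightarrow> open (chart_map c ` chart_dom c)"
  using smooth_atlas by (auto simp: smooth_atlas_def is_chart_def)

lemma openin_chart_dom: "c \<in> A \<Longrightarrow> openin (top_of_set M) (chart_dom c)"
  using smooth_atlas by (auto simp: smooth_atlas_def is_chart_def)

lemma chart_dom_subset: "c \<in> A \<Longrightarrow> chart_dom c \<subseteq> M"
  using openin_chart_dom openin_imp_subset by blast

lemma chart_inv_chart_map [simp]: "c \<in> A \<Longrightarrow> p \<in> chart_dom c \<Longrightarrow> chart_inv c (chart_map c p) = p"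
  using homeomorphism_apply1[OF chart_homeomorphism] .

lemma chart_map_chart_inv [simp]: "c \<in> A \<Longrightarrow> x \<in> chart_map c ` chart_dom c \<Longrightarrow> chart_map c (chart_inv c x) = x"
  using homeomorphism_apply2[OF chart_homeomorphism] .

lemma chart_inv_in_dom: "c \<in> A \<Longrightarrow> x \<in> chart_map c ` chart_dom c \<Longrightarrow> chart_inv c x \<in> chart_dom c"
  by auto

lemma open_chart_map_image:
  assumes "c \<in> A" "openin (top_of_set M) V"
  shows "open (chart_map c ` (chart_dom c \<inter> V))"
proof -
  have "openin (top_of_set (chart_dom c)) (chart_dom c \<inter> V)"
    using assms chart_dom_subset[OF assms(1)] by (auto simp: openin_open)
  then have "openin (top_of_set (chart_map c ` chart_dom c)) (chart_map c ` (chart_dom c \<inter> V))"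
    using homeomorphism_imp_open_map[OF chart_homeomorphism[OF assms(1)]] by blast
  then show ?thesis using open_chart_image[OF assms(1)] openin_open_trans by blast
qed

lemma chart_at_in_charts_at: "p \<in> M \<Longrightarrow> chart_at A p \<in> charts_at A p"
  unfolding chart_at_def using smooth_atlas
  by (intro someI_ex[of "\<lambda>c. c \<in> charts_at A p"]) (auto simp: smooth_atlas_def charts_at_def)

lemma charts_atD: "c \<in> charts_at A p \<Longrightarrow> c \<in> A" "c \<in> charts_at A p \<Longrightarrow> p \<in> chart_dom c"
  by (auto simp: charts_at_def)

lemma charts_at_in_M: "c \<in> charts_at A p \<Longrightarrow> p \<in> M"
  using chart_dom_subset charts_atD by blast

lemma charts_at_chart_inv: "c \<in> A \<Longrightarrow> x \<in> chart_map c ` chart_dom c \<Longrightarrow> c \<in> charts_at A (chart_inv c x)"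
  by (auto simp: charts_at_def)

text \<open>The target has a single chart, the identity on the whole space. The converse must also
  recover the continuity on \<open>M\<close> that \<open>smooth_map\<close> demands
  separately.\<close>

lemma smooth_fun_iff:
  "smooth_fun M A f \<longleftrightarrow> (\<forall>c\<in>A. smooth_on (chart_map c ` chart_dom c) (f \<circ> chart_inv c))"
proof
  assume "smooth_fun M A f"
  then show "\<forall>c\<in>A. smooth_on (chart_map c ` chart_dom c) (f \<circ> chart_inv c)"
    by (simp add: smooth_fun_def smooth_map_def euclidean_atlas_def comp_def)
next
  assume *: "\<forall>c\<in>A. smooth_on (chart_map c ` chart_dom c) (f \<circ> chart_inv c)"
  have "continuous_on (chart_dom c) f" if c: "c \<in> A" for c
  proof -
    have "continuous_on (chart_dom c) ((f \<circ> chart_inv c) \<circ> chart_map c)"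
      using * c homeomorphism_cont1[OF chart_homeomorphism[OF c]]
      by (intro continuous_on_compose smooth_on_imp_continuous_on) auto
    then show ?thesis using c by (simp cong: continuous_on_cong)
  qed
  note cont = this
  have "continuous_on M f" unfolding continuous_on_def
  proof
    fix p assume "p \<in> M"
    then obtain c where c: "c \<in> A" "p \<in> chart_dom c"
      using smooth_atlas by (auto simp: smooth_atlas_def)
    then obtain T where T: "open T" "chart_dom c = M \<inter> T"
      using openin_chart_dom[OF c(1)] unfolding openin_open by blast
    \<comment> \<open>The chart domain is relatively open, so a limit within it is a limit within
      \<open>M\<close>.\<close>
    then have "at p within M = at p within chart_dom c"
      using c(2) by (intro at_within_nhd[of p T]) auto
    then show "(f \<longlongrightarrow> f p) (at p within M)"
      using cont[OF c(1)] c(2) by (simp add: continuous_on_def)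
  qed
  then show "smooth_fun M A f"
    using * by (simp add: smooth_fun_def smooth_map_def euclidean_atlas_def comp_def)
qed

lemma smooth_funD: "smooth_fun M A f \<Longrightarrow> c \<in> A \<Longrightarrow> smooth_on (chart_map c ` chart_dom c) (f \<circ> chart_inv c)"
  by (simp add: smooth_fun_iff)

lemma smooth_fun_has_derivative:
  assumes "smooth_fun M A f" "c \<in> charts_at A p"
  shows "((f \<circ> chart_inv c) has_derivative frechet_derivative (f \<circ> chart_inv c) (at (chart_map c p))) (at (chart_map c p))"
  using assms by (intro smooth_on_has_derivative[OF smooth_funD]) (auto simp: charts_at_def)

lemma smooth_fun_cong:
  assumes "\<And>p. p \<in> M \<Longrightarrow> f p = g p"
  shows "smooth_fun M A f \<longleftrightarrow> smooth_fun M A g"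
proof -
  have "smooth_on (chart_map c ` chart_dom c) (f \<circ> chart_inv c) \<longleftrightarrow> smooth_on (chart_map c ` chart_dom c) (g \<circ> chart_inv c)"
    if "c \<in> A" for c
    using assms chart_dom_subset[OF that] that by (intro smooth_on_cong open_chart_image) auto
  then show ?thesis by (simp add: smooth_fun_iff)
qed

lemma smooth_fun_bounded_linear:
  "bounded_linear L \<Longrightarrow> smooth_fun M A f \<Longrightarrow> smooth_fun M A (\<lambda>p. L (f p))"
  using smooth_on_bounded_linear[OF open_chart_image, of _ L "f \<circ> chart_inv _"]
  by (simp add: smooth_fun_iff comp_def)

lemma smooth_fun_sum:
  "(\<And>i. i \<in> I \<Longrightarrow> smooth_fun M A (f i)) \<Longrightarrow> smooth_fun M A (\<lambda>p. \<Sum>i\<in>I. f i p)"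
  using smooth_on_sum[OF open_chart_image, of _ I "\<lambda>i. f i \<circ> chart_inv _"]
  by (simp add: smooth_fun_iff comp_def)

abbreviation transition :: "('a, 'b) chart \<Rightarrow> ('a, 'b) chart \<Rightarrow> 'b \<Rightarrow> 'b" where
  "transition c c' \<equiv> chart_map c' \<circ> chart_inv c"

lemma open_overlap: "c \<in> A \<Longrightarrow> c' \<in> A \<Longrightarrow> open (chart_map c ` (chart_dom c \<inter> chart_dom c'))"
  by (simp add: open_chart_map_image openin_chart_dom)

lemma transition_has_derivative:
  assumes "c \<in> charts_at A p" "c' \<in> charts_at A p"
  shows "(transition c c' has_derivative frechet_derivative (transition c c') (at (chart_map c p))) (at (chart_map c p))"
proof (rule smooth_on_has_derivative)
  show "smooth_on (chart_map c ` (chart_dom c \<inter> chart_dom c')) (transition c c')"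
    using smooth_atlas assms[THEN charts_atD(1)] unfolding smooth_atlas_def by blast
  show "chart_map c p \<in> chart_map c ` (chart_dom c \<inter> chart_dom c')"
    using assms[THEN charts_atD(2)] by blast
qed

text \<open>The chain rule on the overlap of two charts. With \<open>f\<close> a function on
  \<open>M\<close> it gives the chart independence of \<open>tderiv\<close>; with \<open>f\<close> a
  third chart map it is the cocycle rule behind \<open>chart_vec_in_tangent_space\<close>.\<close>

lemma frechet_derivative_compose_transition:
  assumes c: "c \<in> charts_at A p" "c' \<in> charts_at A p"
    and d: "((f \<circ> chart_inv c') has_derivative D) (at (chart_map c' p))"
  shows "frechet_derivative (f \<circ> chart_inv c) (at (chart_map c p)) b
    = D (frechet_derivative (transition c c') (at (chart_map c p)) b)"
proof -
  have "transition c c' (chart_map c p) = chart_map c' p"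
    using c by (simp add: charts_at_def)
  with d have "((f \<circ> chart_inv c') has_derivative D) (at (transition c c' (chart_map c p)))"
    by (simp only:)
  from diff_chain_at[OF transition_has_derivative[OF c] this]
  have "((f \<circ> chart_inv c) has_derivative
      D \<circ> frechet_derivative (transition c c') (at (chart_map c p))) (at (chart_map c p))"
  proof (rule has_derivative_transform_within_open)
    show "open (chart_map c ` (chart_dom c \<inter> chart_dom c'))"
      using c by (intro open_overlap charts_atD)
    show "chart_map c p \<in> chart_map c ` (chart_dom c \<inter> chart_dom c')"
      using c[THEN charts_atD(2)] by blast
    show "(f \<circ> chart_inv c' \<circ> transition c c') y = (f \<circ> chart_inv c) y"
      if "y \<in> chart_map c ` (chart_dom c \<inter> chart_dom c')" for y
      using that c[THEN charts_atD(1)] by auto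
  qed
  from frechet_derivative_at[OF this, symmetric] show ?thesis by simp
qed

lemma frechet_derivative_transition_self:
  assumes "c \<in> charts_at A p"
  shows "frechet_derivative (transition c c) (at (chart_map c p)) = (\<lambda>b. b)"
proof -
  have "frechet_derivative (transition c c) (at (chart_map c p)) = frechet_derivative (\<lambda>x. x) (at (chart_map c p))"
    using assms by (intro frechet_derivative_cong[OF open_chart_image[of c]]) (auto simp: charts_at_def)
  then show ?thesis by simp
qed

section \<open>Tangent vectors and directional derivatives\<close>

lemma tangent_spaceI:
  assumes "\<And>c. c \<notin> charts_at A p \<Longrightarrow> \<xi> c = 0"
    and "\<And>c c'. c \<in> charts_at A p \<Longrightarrow> c' \<in> charts_at A p \<Longrightarrow>
      \<xi> c' = frechet_derivative (transition c c') (at (chart_map c p)) (\<xi> c)"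
  shows "\<xi> \<in> tangent_space A p"
  unfolding tangent_space_def using assms by blast

lemma tangent_space_transition:
  "\<xi> \<in> tangent_space A p \<Longrightarrow> c \<in> charts_at A p \<Longrightarrow> c' \<in> charts_at A p \<Longrightarrow>
    \<xi> c' = frechet_derivative (transition c c') (at (chart_map c p)) (\<xi> c)"
  unfolding tangent_space_def by blast

lemma tangent_space_zero: "\<xi> \<in> tangent_space A p \<Longrightarrow> c \<notin> charts_at A p \<Longrightarrow> \<xi> c = 0"
  unfolding tangent_space_def by blast

lemma chart_vec_in_tangent_space:
  assumes "c \<in> charts_at A p"
  shows "chart_vec A c p b \<in> tangent_space A p"
proof (rule tangent_spaceI)
  fix c' c'' assume c': "c' \<in> charts_at A p" "c'' \<in> charts_at A p"
  have "frechet_derivative (transition c c'') (at (chart_map c p)) b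
    = frechet_derivative (transition c' c'') (at (chart_map c' p))
        (frechet_derivative (transition c c') (at (chart_map c p)) b)"
    by (rule frechet_derivative_compose_transition[OF assms c'(1) transition_has_derivative[OF c']])
  with c' show "chart_vec A c p b c'' = frechet_derivative (transition c' c'') (at (chart_map c' p)) (chart_vec A c p b c')"
    by (simp only: chart_vec_def if_True)
qed (simp add: chart_vec_def)

lemma chart_vec_self [simp]: "c \<in> charts_at A p \<Longrightarrow> chart_vec A c p b c = b"
  by (simp add: chart_vec_def frechet_derivative_transition_self)

text \<open>One component determines all others through the transition rule and the convention that
  components are 0 off \<open>charts_at A p\<close>. Identities between tangent vectors can thus be
  checked in a single chart.\<close>

lemma tangent_space_eqI:
  assumes "\<xi> \<in> tangent_space A p" "\<eta> \<in> tangent_space A p" "c \<in> charts_at A p" "\<xi> c = \<eta> c"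
  shows "\<xi> = \<eta>"
proof
  fix c'
  show "\<xi> c' = \<eta> c'"
  proof (cases "c' \<in> charts_at A p")
    case True
    from tangent_space_transition[OF assms(1,3) True] tangent_space_transition[OF assms(2,3) True]
    show ?thesis unfolding assms(4) by (rule trans[OF _ sym])
  qed (use assms tangent_space_zero in metis)
qed

text \<open>Transition derivatives are linear. The cases of an empty and of a one-element
  \<open>I\<close> supply the zero vector and scalar multiples.\<close>

lemma tangent_space_sum:
  assumes "\<And>i. i \<in> I \<Longrightarrow> \<xi> i \<in> tangent_space A p"
  shows "(\<lambda>c. \<Sum>i\<in>I. a i *\<^sub>R \<xi> i c) \<in> tangent_space A p"
proof (rule tangent_spaceI)
  fix c c' assume c: "c \<in> charts_at A p" "c' \<in> charts_at A p"
  have "linear (frechet_derivative (transition c c') (at (chart_map c p)))"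
    using transition_has_derivative[OF c] has_derivative_linear by blast
  then have "frechet_derivative (transition c c') (at (chart_map c p)) (\<Sum>i\<in>I. a i *\<^sub>R \<xi> i c)
      = (\<Sum>i\<in>I. a i *\<^sub>R frechet_derivative (transition c c') (at (chart_map c p)) (\<xi> i c))"
    by (simp only: linear_sum linear_scale)
  also have "\<dots> = (\<Sum>i\<in>I. a i *\<^sub>R \<xi> i c')"
    by (rule sum.cong[OF refl]) (simp only: tangent_space_transition[OF assms c, symmetric])
  finally show "(\<Sum>i\<in>I. a i *\<^sub>R \<xi> i c') =
      frechet_derivative (transition c c') (at (chart_map c p)) (\<Sum>i\<in>I. a i *\<^sub>R \<xi> i c)" ..
qed (simp add: tangent_space_zero[OF assms])

text \<open>This replaces the chart selected at \<open>p\<close> by any chart around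
  \<open>p\<close>, so that along a neighbourhood one fixed chart can be used and the result
  differentiated again.\<close>

lemma tderiv_chart:
  assumes "smooth_fun M A f" "c \<in> charts_at A p" "\<xi> \<in> tangent_space A p"
  shows "tderiv A f p \<xi> = frechet_derivative (f \<circ> chart_inv c) (at (chart_map c p)) (\<xi> c)"
proof -
  let ?c = "chart_at A p"
  have c: "?c \<in> charts_at A p" using assms(2) by (intro chart_at_in_charts_at charts_at_in_M)
  have "\<xi> ?c = frechet_derivative (transition c ?c) (at (chart_map c p)) (\<xi> c)"
    by (rule tangent_space_transition[OF assms(3,2) c])
  then show ?thesis
    using frechet_derivative_compose_transition[OF assms(2) c smooth_fun_has_derivative[OF assms(1) c]]
    by (simp add: tderiv_def Let_def)
qed

lemma tderiv_sum:
  assumes "smooth_fun M A f" "p \<in> M" "\<And>i. i \<in> I \<Longrightarrow> \<xi> i \<in> tangent_space A p"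
  shows "tderiv A f p (\<lambda>c. \<Sum>i\<in>I. a i *\<^sub>R \<xi> i c) = (\<Sum>i\<in>I. a i *\<^sub>R tderiv A f p (\<xi> i))"
proof -
  have "linear (frechet_derivative (f \<circ> chart_inv (chart_at A p)) (at (chart_map (chart_at A p) p)))"
    using smooth_fun_has_derivative[OF assms(1) chart_at_in_charts_at[OF assms(2)]] has_derivative_linear by blast
  then show ?thesis by (simp add: tderiv_def Let_def linear_sum linear_scale)
qed

section \<open>Vector fields as differential operators\<close>

lemma vfield_apply_chart:
  assumes "smooth_fun M A f" "c \<in> charts_at A p" "X p \<in> tangent_space A p"
  shows "vfield_apply A X f p = frechet_derivative (f \<circ> chart_inv c) (at (chart_map c p)) (X p c)"
  using tderiv_chart[OF assms] by (simp add: vfield_apply_def)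

text \<open>Identities between functions are available only on \<open>M\<close>; that suffices,
  because chart inverses map chart images into \<open>M\<close>.\<close>

lemma vfield_apply_cong:
  assumes "\<And>q. q \<in> M \<Longrightarrow> f q = g q" "p \<in> M"
  shows "vfield_apply A X f p = vfield_apply A X g p"
proof -
  have c: "chart_at A p \<in> charts_at A p" by (rule chart_at_in_charts_at[OF assms(2)])
  have "frechet_derivative (f \<circ> chart_inv (chart_at A p)) (at (chart_map (chart_at A p) p))
    = frechet_derivative (g \<circ> chart_inv (chart_at A p)) (at (chart_map (chart_at A p) p))"
    by (rule frechet_derivative_cong[OF open_chart_image[OF charts_atD(1)[OF c]]])
      (use c assms(1) chart_dom_subset[OF charts_atD(1)[OF c]] in \<open>auto simp: charts_at_def\<close>)
  then show ?thesis by (simp add: vfield_apply_def tderiv_def Let_def)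
qed

lemma vfield_apply_bounded_linear:
  assumes "bounded_linear L" "smooth_fun M A f" "p \<in> M"
  shows "vfield_apply A X (\<lambda>q. L (f q)) p = L (vfield_apply A X f p)"
proof -
  have "(f \<circ> chart_inv (chart_at A p)) differentiable (at (chart_map (chart_at A p) p))"
    using smooth_fun_has_derivative[OF assms(2) chart_at_in_charts_at[OF assms(3)]] differentiable_def by blast
  from frechet_derivative_bounded_linear[OF assms(1) this] show ?thesis
    by (simp add: vfield_apply_def tderiv_def Let_def comp_def)
qed

lemma vfield_apply_sum:
  assumes "\<And>i. i \<in> I \<Longrightarrow> smooth_fun M A (f i)" "p \<in> M"
  shows "vfield_apply A X (\<lambda>q. \<Sum>i\<in>I. f i q) p = (\<Sum>i\<in>I. vfield_apply A X (f i) p)"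
proof -
  have "((\<lambda>y. \<Sum>i\<in>I. (f i \<circ> chart_inv (chart_at A p)) y) has_derivative
      (\<lambda>h. \<Sum>i\<in>I. frechet_derivative (f i \<circ> chart_inv (chart_at A p)) (at (chart_map (chart_at A p) p)) h))
      (at (chart_map (chart_at A p) p))"
    by (intro has_derivative_sum smooth_fun_has_derivative assms chart_at_in_charts_at)
  from frechet_derivative_at[OF this, symmetric] show ?thesis
    by (simp add: vfield_apply_def tderiv_def Let_def comp_def)
qed

lemma smooth_fun_vfield_apply:
  assumes "smooth_vfield M A X" "smooth_fun M A f"
  shows "smooth_fun M A (vfield_apply A X f)"
  unfolding smooth_fun_iff
proof
  fix c assume c: "c \<in> A"
  have "smooth_on (chart_map c ` chart_dom c)
      (\<lambda>y. frechet_derivative (f \<circ> chart_inv c) (at y) (X (chart_inv c y) c))"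
    using assms c by (intro smooth_on_frechet_derivative open_chart_image smooth_funD) (auto simp: smooth_vfield_def)
  moreover have "(vfield_apply A X f \<circ> chart_inv c) y
      = frechet_derivative (f \<circ> chart_inv c) (at y) (X (chart_inv c y) c)"
    if "y \<in> chart_map c ` chart_dom c" for y
    using vfield_apply_chart[OF assms(2) charts_at_chart_inv[OF c that], of X] that c assms(1)
      chart_dom_subset[OF c] chart_inv_in_dom[OF c that]
    by (auto simp: smooth_vfield_def)
  ultimately show "smooth_on (chart_map c ` chart_dom c) (vfield_apply A X f \<circ> chart_inv c)"
    by (subst smooth_on_cong[OF open_chart_image[OF c]])
qed

text \<open>The chain rule along the curve. The second premise keeps the curve in the chart domain
  for nearby times, where the transition map composed with one coordinate expression of the curve
  gives the other.\<close>

lemma velocity_in_tangent_space: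
  assumes d: "\<And>c. c \<in> charts_at A (\<gamma> t) \<Longrightarrow> (chart_map c \<circ> \<gamma>) differentiable (at t)"
    and e: "\<And>c. c \<in> charts_at A (\<gamma> t) \<Longrightarrow> \<forall>\<^sub>F s in nhds t. \<gamma> s \<in> chart_dom c"
  shows "velocity A \<gamma> t \<in> tangent_space A (\<gamma> t)"
proof -
  have *: "vector_derivative (chart_map c' \<circ> \<gamma>) (at t) =
      frechet_derivative (transition c c') (at (chart_map c (\<gamma> t))) (vector_derivative (chart_map c \<circ> \<gamma>) (at t))"
    if c: "c \<in> charts_at A (\<gamma> t)" "c' \<in> charts_at A (\<gamma> t)" for c c'
  proof -
    have "((chart_map c \<circ> \<gamma>) has_vector_derivative vector_derivative (chart_map c \<circ> \<gamma>) (at t)) (at t)"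
      using d[OF c(1)] vector_derivative_works by blast
    moreover have "(transition c c' has_derivative frechet_derivative (transition c c') (at (chart_map c (\<gamma> t))))
        (at ((chart_map c \<circ> \<gamma>) t) within range (chart_map c \<circ> \<gamma>))"
      unfolding comp_apply[of "chart_map c" \<gamma>]
      by (rule has_derivative_at_withinI[OF transition_has_derivative[OF c]])
    ultimately have "(transition c c' \<circ> (chart_map c \<circ> \<gamma>) has_vector_derivative
       frechet_derivative (transition c c') (at (chart_map c (\<gamma> t))) (vector_derivative (chart_map c \<circ> \<gamma>) (at t))) (at t)"
      by (rule vector_derivative_diff_chain_within)
    moreover have "\<forall>\<^sub>F s in nhds t. s \<in> UNIV \<longrightarrow> (transition c c' \<circ> (chart_map c \<circ> \<gamma>)) s = (chart_map c' \<circ> \<gamma>) s"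
      using e[OF c(1)] by eventually_elim (use charts_atD(1)[OF c(1)] in simp)
    moreover from this have "(transition c c' \<circ> (chart_map c \<circ> \<gamma>)) t = (chart_map c' \<circ> \<gamma>) t"
      using eventually_nhds_x_imp_x by fastforce
    ultimately have "((chart_map c' \<circ> \<gamma>) has_vector_derivative
       frechet_derivative (transition c c') (at (chart_map c (\<gamma> t))) (vector_derivative (chart_map c \<circ> \<gamma>) (at t))) (at t)"
      using has_vector_derivative_cong_ev by blast
    then show "vector_derivative (chart_map c' \<circ> \<gamma>) (at t) =
      frechet_derivative (transition c c') (at (chart_map c (\<gamma> t))) (vector_derivative (chart_map c \<circ> \<gamma>) (at t))"
      by (rule vector_derivative_at)
  qed
  show ?thesis
  proof (rule tangent_spaceI)
    fix c c' assume "c \<in> charts_at A (\<gamma> t)" "c' \<in> charts_at A (\<gamma> t)"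
    with *[OF this] show "velocity A \<gamma> t c' = frechet_derivative (transition c c') (at (chart_map c (\<gamma> t))) (velocity A \<gamma> t c)"
      by (simp only: velocity_def if_True)
  qed (simp add: velocity_def)
qed

end

section \<open>Angle coordinates\<close>

definition torus_cube :: "real^'m \<Rightarrow> (real^'m) set" where
  "torus_cube a = {\<theta>. \<forall>i. \<bar>\<theta> $ i - a $ i\<bar> < pi}"

text \<open>The members of \<open>torus_atlas\<close>, named by the centre of the cube so that a
  branch can be centred at any given angles.\<close>

definition torus_chart :: "real^'m \<Rightarrow> (complex^'m, real^'m) chart" where
  "torus_chart a = (torus_exp ` torus_cube a, inv_into (torus_cube a) torus_exp)"

lemma torus_chart_in_atlas: "torus_chart a \<in> torus_atlas"
  by (auto simp: torus_atlas_def torus_chart_def torus_cube_def Let_def)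

text \<open>Angles with equal exponentials differ by a multiple of 2 pi, and within the cube the
  difference is less than 2 pi in absolute value.\<close>

lemma inj_on_torus_exp:
  fixes a :: "real^'m"
  shows "inj_on torus_exp (torus_cube a)"
proof (rule inj_onI)
  fix \<theta> \<eta> :: "real^'m" assume *: "\<theta> \<in> torus_cube a" "\<eta> \<in> torus_cube a" "torus_exp \<theta> = torus_exp \<eta>"
  have "\<theta> $ i = \<eta> $ i" for i
  proof -
    have "cis (\<theta> $ i) = cis (\<eta> $ i)" using *(3) by (simp add: torus_exp_def vec_eq_iff)
    then have "sin (\<theta> $ i) = sin (\<eta> $ i) \<and> cos (\<theta> $ i) = cos (\<eta> $ i)"
      by (simp add: complex_eq_iff)
    then obtain n :: int where n: "\<theta> $ i = \<eta> $ i + 2 * pi * n"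
      using sin_cos_eq_iff by blast
    have "\<bar>\<theta> $ i - a $ i\<bar> < pi" "\<bar>\<eta> $ i - a $ i\<bar> < pi"
      using *(1,2) by (auto simp: torus_cube_def)
    then have "\<bar>2 * pi * n\<bar> < 2 * pi" using n by linarith
    then have "\<bar>real_of_int n\<bar> < 1" by (simp add: abs_mult)
    then have "n = 0" by linarith
    with n show ?thesis by simp
  qed
  then show "\<theta> = \<eta>" by (simp add: vec_eq_iff)
qed

lemma torus_chart_map_exp [simp]: "\<theta> \<in> torus_cube a \<Longrightarrow> chart_map (torus_chart a) (torus_exp \<theta>) = \<theta>"
  by (simp add: torus_chart_def inj_on_torus_exp inv_into_f_f)

lemma torus_chart_inv [simp]: "\<theta> \<in> torus_cube a \<Longrightarrow> chart_inv (torus_chart a) \<theta> = torus_exp \<theta>"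
proof -
  assume \<theta>: "\<theta> \<in> torus_cube a"
  have "inj_on (chart_map (torus_chart a)) (chart_dom (torus_chart a))"
    by (auto simp: torus_chart_def intro: inj_on_inv_into)
  moreover have "torus_exp \<theta> \<in> chart_dom (torus_chart a)" using \<theta> by (simp add: torus_chart_def)
  ultimately show ?thesis
    unfolding chart_inv_def using inv_into_f_f torus_chart_map_exp[OF \<theta>] by metis
qed

lemma continuous_on_torus_exp: "continuous_on S torus_exp"
  unfolding torus_exp_def by (intro continuous_intros)

lemma torus_exp_in_torus: "torus_exp \<theta> \<in> torus"
  by (simp add: torus_def torus_exp_def)

lemma torus_exp_surj:
  assumes "w \<in> torus"
  obtains \<theta> where "torus_exp \<theta> = w"
proof
  show "torus_exp (\<chi> i. Arg (w $ i)) = w"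
    using assms rcis_cmod_Arg[of "w $ _"] by (simp add: torus_exp_def torus_def vec_eq_iff rcis_def)
qed

lemma cis_notin_nonpos_Reals:
  assumes "\<bar>t\<bar> < pi"
  shows "cis t \<notin> \<real>\<^sub>\<le>\<^sub>0"
proof
  assume "cis t \<in> \<real>\<^sub>\<le>\<^sub>0"
  then have "Re (cis t) \<le> 0" "Im (cis t) = 0" by (auto simp: complex_nonpos_Reals_iff)
  then have *: "cos t \<le> 0" "sin t = 0" by auto
  have "t = 0"
  proof -
    obtain n :: int where n: "t = real_of_int n * pi" using *(2) sin_zero_iff_int2 by blast
    with assms have "\<bar>real_of_int n\<bar> * pi < 1 * pi" by (simp add: abs_mult)
    then have "\<bar>real_of_int n\<bar> < 1" using mult_less_cancel_right_pos pi_gt_zero by blast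
    then have "n = 0" by linarith
    with n show ?thesis by simp
  qed
  with *(1) show False by simp
qed

lemma open_torus_cube:
  fixes a :: "real^'m"
  shows "open (torus_cube a)"
proof -
  have "torus_cube a = (\<Inter>i\<in>UNIV. {\<theta>. \<bar>\<theta> $ i - a $ i\<bar> < pi})" by (auto simp: torus_cube_def)
  moreover have "open {\<theta> :: real^'m. \<bar>\<theta> $ i - a $ i\<bar> < pi}" for i
    by (intro open_Collect_less continuous_intros)
  ultimately show ?thesis by (simp add: open_INT)
qed

text \<open>Rotating the i-th component by minus the i-th angle of the centre moves the angle
  missing from the cube onto the nonpositive real axis. The domain is thus the part of the torus
  where finitely many open conditions hold.\<close>

lemma openin_torus_chart_dom:
  fixes a :: "real^'m"
  shows "openin (top_of_set torus) (chart_dom (torus_chart a))"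
proof -
  let ?T = "\<Inter>i\<in>UNIV. {w :: complex^'m. w $ i * cis (- (a $ i)) \<in> - \<real>\<^sub>\<le>\<^sub>0}"
  have "chart_dom (torus_chart a) = torus \<inter> ?T"
  proof (intro equalityI subsetI)
    fix w assume "w \<in> chart_dom (torus_chart a)"
    then obtain \<theta> where \<theta>: "\<theta> \<in> torus_cube a" "w = torus_exp \<theta>" by (auto simp: torus_chart_def)
    have "w $ i * cis (- (a $ i)) = cis (\<theta> $ i - a $ i)" for i
      by (simp add: \<theta>(2) torus_exp_def cis_mult)
    then show "w \<in> torus \<inter> ?T"
      using \<theta> cis_notin_nonpos_Reals[of "\<theta> $ _ - a $ _"] by (auto simp: torus_cube_def torus_exp_in_torus)
  next
    fix w assume w: "w \<in> torus \<inter> ?T"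
    define z where "z i = w $ i * cis (- (a $ i))" for i
    \<comment> \<open>Off the cut the principal argument lies strictly between -pi and pi, so adding
      it to \<open>a\<close> gives a preimage inside the cube.\<close>
    define \<theta> where "\<theta> = (\<chi> i. a $ i + Arg (z i))"
    have z: "norm (z i) = 1" "z i \<notin> \<real>\<^sub>\<le>\<^sub>0" for i using w by (auto simp: z_def torus_def norm_mult)
    have "\<bar>Arg (z i)\<bar> < pi" for i
      using Arg_bounded[of "z i"] z(2)[of i] Arg_eq_pi_iff[of "z i"]
      by (cases "Arg (z i) = pi") (auto simp: complex_nonpos_Reals_iff complex_is_Real_iff)
    then have "\<theta> \<in> torus_cube a" by (simp add: torus_cube_def \<theta>_def)
    have "torus_exp \<theta> $ i = w $ i" for i
    proof -
      have "torus_exp \<theta> $ i = cis (a $ i) * cis (Arg (z i))" by (simp add: torus_exp_def \<theta>_def cis_mult)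
      also have "cis (Arg (z i)) = z i" using rcis_cmod_Arg[of "z i"] z(1)[of i] by (simp add: rcis_def)
      also have "cis (a $ i) * z i = w $ i * (cis (a $ i) * cis (- (a $ i)))" by (simp add: z_def)
      also have "\<dots> = w $ i" by (simp add: cis_mult)
      finally show ?thesis .
    qed
    then have "torus_exp \<theta> = w" by (simp add: vec_eq_iff)
    with \<open>\<theta> \<in> torus_cube a\<close> show "w \<in> chart_dom (torus_chart a)"
      unfolding torus_chart_def by auto
  qed
  moreover have "open {w :: complex^'m. w $ i * cis (- (a $ i)) \<in> - \<real>\<^sub>\<le>\<^sub>0}" for i
    using open_vimage[of "- \<real>\<^sub>\<le>\<^sub>0" "\<lambda>w. w $ i * cis (- (a $ i))"]
    by (simp add: vimage_def open_Compl continuous_intros)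
  then have "open ?T" by (intro open_INT) auto
  ultimately show ?thesis by (auto simp: openin_open)
qed

locale torus_diffeo = atlas M A
  for M :: "'a::topological_space set" and A :: "('a, real^'m) chart set" +
  fixes h :: "'a \<Rightarrow> complex^'m"
  assumes diffeo: "diffeomorphism M A torus torus_atlas h"
begin

abbreviation hinv :: "complex^'m \<Rightarrow> 'a" where "hinv \<equiv> inv_into M h"

lemma bij_h: "bij_betw h M torus"
  using diffeo by (simp add: diffeomorphism_def)

lemma h_in_torus: "p \<in> M \<Longrightarrow> h p \<in> torus"
  using bij_h bij_betwE by blast

lemma hinv_h [simp]: "p \<in> M \<Longrightarrow> hinv (h p) = p"
  using bij_h bij_betw_inv_into_left by metis

lemma h_hinv [simp]: "w \<in> torus \<Longrightarrow> h (hinv w) = w"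
  using bij_h bij_betw_inv_into_right by metis

lemma hinv_in_M: "w \<in> torus \<Longrightarrow> hinv w \<in> M"
  using bij_betwE[OF bij_betw_inv_into[OF bij_h]] by blast

lemma continuous_h: "continuous_on M h"
  using diffeo by (simp add: diffeomorphism_def smooth_map_def)

lemma continuous_hinv: "continuous_on torus hinv"
  using diffeo by (simp add: diffeomorphism_def smooth_map_def)

text \<open>The covering of \<open>M\<close> by Euclidean space. Unlike the angle coordinates it is
  defined globally, and it carries straight coordinate lines to the lines
  \<open>angle_line\<close>.\<close>

definition angle_param :: "(real^'m) \<Rightarrow> 'a" where
  "angle_param \<theta> = hinv (torus_exp \<theta>)"

definition param_dom :: "('a, real^'m) chart \<Rightarrow> (real^'m) set" where
  "param_dom c = {\<theta>. angle_param \<theta> \<in> chart_dom c}"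

lemma angle_param_in_M: "angle_param \<theta> \<in> M"
  by (simp add: angle_param_def hinv_in_M torus_exp_in_torus)

lemma angle_param_surj:
  assumes "p \<in> M"
  obtains \<theta> where "angle_param \<theta> = p"
  using torus_exp_surj[OF h_in_torus[OF assms]] hinv_h[OF assms] unfolding angle_param_def by metis

lemma open_param_dom: "c \<in> A \<Longrightarrow> open (param_dom c)"
proof -
  assume c: "c \<in> A"
  have "continuous_on UNIV angle_param"
    unfolding angle_param_def[abs_def]
    by (rule continuous_on_compose2[OF continuous_hinv continuous_on_torus_exp]) (auto simp: torus_exp_in_torus)
  then have "openin (top_of_set UNIV) (UNIV \<inter> angle_param -` chart_dom c)"
    by (rule continuous_openin_preimage[OF _ _ openin_chart_dom[OF c]]) (auto simp: angle_param_in_M)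
  then show ?thesis by (simp add: param_dom_def vimage_def)
qed

text \<open>On the cube around a point \<open>a\<close> the covering is the inverse diffeomorphism
  read in the torus chart centred at \<open>a\<close>; such cubes reach every point.\<close>

lemma smooth_on_chart_map_angle_param:
  assumes "c \<in> A"
  shows "smooth_on (param_dom c) (chart_map c \<circ> angle_param)"
proof (rule smooth_on_local[OF open_param_dom[OF assms]])
  fix a assume a: "a \<in> param_dom c"
  let ?t = "torus_chart a"
  let ?W = "torus_cube a \<inter> param_dom c"
  have "smooth_on (chart_map ?t ` (chart_dom ?t \<inter> hinv -` chart_dom c)) (chart_map c \<circ> hinv \<circ> chart_inv ?t)"
    using diffeo assms torus_chart_in_atlas[of a] unfolding diffeomorphism_def smooth_map_def by blast
  moreover have "?W \<subseteq> chart_map ?t ` (chart_dom ?t \<inter> hinv -` chart_dom c)"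
  proof
    fix \<theta> assume \<theta>: "\<theta> \<in> ?W"
    then have "torus_exp \<theta> \<in> chart_dom ?t \<inter> hinv -` chart_dom c"
      by (simp add: torus_chart_def param_dom_def angle_param_def)
    moreover have "\<theta> = chart_map ?t (torus_exp \<theta>)" using \<theta> by simp
    ultimately show "\<theta> \<in> chart_map ?t ` (chart_dom ?t \<inter> hinv -` chart_dom c)" by blast
  qed
  ultimately have "smooth_on ?W (chart_map c \<circ> hinv \<circ> chart_inv ?t)" by (rule smooth_on_subset)
  moreover have "open ?W" by (intro open_Int open_torus_cube open_param_dom assms)
  ultimately have "smooth_on ?W (chart_map c \<circ> angle_param)"
    using smooth_on_cong[of ?W "chart_map c \<circ> hinv \<circ> chart_inv ?t" "chart_map c \<circ> angle_param"]
    by (simp add: angle_param_def)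
  with \<open>open ?W\<close> a show "\<exists>T. open T \<and> a \<in> T \<and> T \<subseteq> param_dom c \<and> smooth_on T (chart_map c \<circ> angle_param)"
    by (intro exI[of _ ?W]) (auto simp: torus_cube_def)
qed

text \<open>\<open>cis\<close> turns sums of angles into products. Hence the angle fields are the
  images of the constant fields under the derivative of the covering.\<close>

lemma angle_line_eq: "angle_line M h i (angle_param \<theta>) s = angle_param (\<theta> + s *\<^sub>R axis i 1)"
proof -
  have "(\<chi> j. if j = i then cis s * torus_exp \<theta> $ j else torus_exp \<theta> $ j) = torus_exp (\<theta> + s *\<^sub>R axis i 1)"
    by (simp add: vec_eq_iff torus_exp_def axis_def cis_mult add.commute)
  then show ?thesis
    unfolding angle_line_def angle_param_def h_hinv[OF torus_exp_in_torus] by simp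
qed

lemma angle_param_line_derivative:
  assumes "c \<in> A" "\<theta> \<in> param_dom c"
  shows "((chart_map c \<circ> angle_line M h i (angle_param \<theta>)) has_vector_derivative
    frechet_derivative (chart_map c \<circ> angle_param) (at \<theta>) (axis i 1)) (at 0)"
proof -
  let ?f = "chart_map c \<circ> angle_param"
  have d: "(?f has_derivative frechet_derivative ?f (at \<theta>)) (at \<theta>)"
    by (rule smooth_on_has_derivative[OF smooth_on_chart_map_angle_param[OF assms(1)] assms(2)])
  have "((\<lambda>s. \<theta> + s *\<^sub>R axis i 1) has_vector_derivative axis i 1) (at (0::real))"
    by (auto intro!: derivative_eq_intros)
  moreover have "(?f has_derivative frechet_derivative ?f (at \<theta>))
      (at (\<theta> + 0 *\<^sub>R axis i 1) within range (\<lambda>s. \<theta> + s *\<^sub>R axis i 1))"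
    unfolding scaleR_zero_left add_0_right by (rule has_derivative_at_withinI[OF d])
  ultimately have "((?f \<circ> (\<lambda>s. \<theta> + s *\<^sub>R axis i 1)) has_vector_derivative frechet_derivative ?f (at \<theta>) (axis i 1)) (at 0)"
    by (rule vector_derivative_diff_chain_within)
  moreover have "?f \<circ> (\<lambda>s. \<theta> + s *\<^sub>R axis i 1) = chart_map c \<circ> angle_line M h i (angle_param \<theta>)"
    by (auto simp: angle_line_eq)
  ultimately show ?thesis by simp
qed

lemma angle_line_0: "angle_line M h i (angle_param \<theta>) 0 = angle_param \<theta>"
  by (simp add: angle_line_eq)

lemma angle_vfield_angle_param:
  assumes "c \<in> charts_at A (angle_param \<theta>)"
  shows "angle_vfield M A h i (angle_param \<theta>) c
    = frechet_derivative (chart_map c \<circ> angle_param) (at \<theta>) (axis i 1)"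
proof -
  have "c \<in> A" "\<theta> \<in> param_dom c" using assms by (auto simp: charts_at_def param_dom_def)
  from vector_derivative_at[OF angle_param_line_derivative[OF this]] assms show ?thesis
    by (simp add: angle_vfield_def angle_param_in_M velocity_def angle_line_0)
qed

lemma angle_vfield_in_tangent_space:
  assumes "p \<in> M"
  shows "angle_vfield M A h i p \<in> tangent_space A p"
proof -
  obtain \<theta> where \<theta>: "angle_param \<theta> = p" using angle_param_surj[OF assms] .
  have "velocity A (angle_line M h i p) 0 \<in> tangent_space A (angle_line M h i p 0)"
  proof (rule velocity_in_tangent_space)
    fix c assume "c \<in> charts_at A (angle_line M h i p 0)"
    then have c: "c \<in> A" "\<theta> \<in> param_dom c"
      using angle_line_0[of i \<theta>] by (auto simp: \<theta> charts_at_def param_dom_def)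
    from angle_param_line_derivative[OF c, of i] show "chart_map c \<circ> angle_line M h i p differentiable at 0"
      by (auto simp: \<theta> differentiable_def has_vector_derivative_def)
    have "((\<lambda>s. \<theta> + s *\<^sub>R axis i 1) \<longlongrightarrow> \<theta> + 0 *\<^sub>R axis i 1) (nhds (0::real))"
      by (intro tendsto_intros filterlim_ident)
    then have "\<forall>\<^sub>F s in nhds 0. \<theta> + s *\<^sub>R axis i 1 \<in> param_dom c"
      by (rule topological_tendstoD[OF _ open_param_dom[OF c(1)]]) (simp add: c(2))
    then show "\<forall>\<^sub>F s in nhds 0. angle_line M h i p s \<in> chart_dom c"
      by eventually_elim (simp add: \<theta>[symmetric] angle_line_eq param_dom_def)
  qed
  with assms angle_line_0[of i \<theta>] show ?thesis by (simp add: angle_vfield_def \<theta>)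
qed

text \<open>\<psi> is the branch of the angles in a torus chart, hence a local inverse of
  \<open>angle_param\<close>. Differentiating the identity \<psi>(c(\<open>angle_param\<close>
  \<theta>)) = \<theta> and inserting e_i gives the last property, because D(c o
  \<open>angle_param\<close>) maps e_i to the i-th angle field.\<close>

lemma angle_coordinates:
  assumes "c \<in> charts_at A p"
  obtains U \<psi> where "open U" "chart_map c p \<in> U" "U \<subseteq> chart_map c ` chart_dom c"
    "smooth_on U \<psi>" "\<And>y. y \<in> U \<Longrightarrow> angle_param (\<psi> y) = chart_inv c y"
    "\<And>i y. y \<in> U \<Longrightarrow> frechet_derivative \<psi> (at y) (angle_vfield M A h i (chart_inv c y) c) = axis i 1"
proof -
  have cA: "c \<in> A" and p: "p \<in> M" using assms charts_atD(1) charts_at_in_M by blast+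
  \<comment> \<open>Centring the branch at angles of \<open>p\<close> puts \<open>p\<close> into its
    domain.\<close>
  obtain a where a: "angle_param a = p" using angle_param_surj[OF p] .
  let ?t = "torus_chart a"
  let ?V = "chart_dom c \<inter> h -` chart_dom ?t"
  define U where "U = chart_map c ` ?V"
  define \<psi> where "\<psi> = chart_map ?t \<circ> h \<circ> chart_inv c"
  have "openin (top_of_set M) (M \<inter> h -` chart_dom ?t)"
    by (rule continuous_openin_preimage[OF continuous_h _ openin_torus_chart_dom]) (auto simp: h_in_torus)
  then have "open (chart_map c ` (chart_dom c \<inter> (M \<inter> h -` chart_dom ?t)))"
    by (rule open_chart_map_image[OF cA])
  moreover have "chart_dom c \<inter> (M \<inter> h -` chart_dom ?t) = ?V" using chart_dom_subset[OF cA] by blast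
  ultimately have U: "open U" by (simp add: U_def)
  have "a \<in> torus_cube a" by (simp add: torus_cube_def)
  then have "torus_exp a \<in> chart_dom ?t" by (simp add: torus_chart_def)
  moreover have "h p = torus_exp a" using a by (auto simp: angle_param_def torus_exp_in_torus)
  ultimately have xU: "chart_map c p \<in> U"
    unfolding U_def using charts_atD(2)[OF assms] by auto
  have sub: "U \<subseteq> chart_map c ` chart_dom c" by (auto simp: U_def)
  have smooth: "smooth_on U \<psi>"
    using diffeo cA torus_chart_in_atlas[of a] unfolding diffeomorphism_def smooth_map_def U_def \<psi>_def by blast
  have \<psi>: "\<psi> y \<in> torus_cube a \<and> angle_param (\<psi> y) = chart_inv c y" if y: "y \<in> U" for y
  proof -
    obtain q where q: "q \<in> chart_dom c" "h q \<in> chart_dom ?t" "y = chart_map c q"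
      using y by (auto simp: U_def)
    then obtain \<theta> where \<theta>: "\<theta> \<in> torus_cube a" "h q = torus_exp \<theta>" by (auto simp: torus_chart_def)
    have "\<psi> y = \<theta>" using q cA \<theta> by (simp add: \<psi>_def)
    moreover have "angle_param \<theta> = q"
      using q(1) chart_dom_subset[OF cA] by (auto simp: angle_param_def \<theta>(2)[symmetric])
    ultimately show ?thesis using \<theta> q cA by simp
  qed
  have D: "frechet_derivative \<psi> (at y) (angle_vfield M A h i (chart_inv c y) c) = axis i 1" if y: "y \<in> U" for i y
  proof -
    let ?f = "chart_map c \<circ> angle_param"
    have c: "c \<in> charts_at A (angle_param (\<psi> y))"
      using \<psi>[OF y] charts_at_chart_inv[OF cA] sub y by auto
    have W: "\<psi> y \<in> param_dom c" using c by (simp add: param_dom_def charts_at_def)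
    have fy: "?f (\<psi> y) = y" using \<psi>[OF y] cA sub y by auto
    have df: "(?f has_derivative frechet_derivative ?f (at (\<psi> y))) (at (\<psi> y))"
      by (rule smooth_on_has_derivative[OF smooth_on_chart_map_angle_param[OF cA] W])
    have "(\<psi> has_derivative frechet_derivative \<psi> (at y)) (at (?f (\<psi> y)))"
      unfolding fy by (rule smooth_on_has_derivative[OF smooth y])
    from diff_chain_at[OF df this]
    have "(\<psi> \<circ> ?f has_derivative frechet_derivative \<psi> (at y) \<circ> frechet_derivative ?f (at (\<psi> y))) (at (\<psi> y))" .
    \<comment> \<open>The composite is the identity only on the cube of the branch, since \<psi>
      returns the representative of the angles in that cube.\<close>
    moreover have "(\<psi> \<circ> ?f has_derivative (\<lambda>v. v)) (at (\<psi> y))"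
    proof (rule has_derivative_transform_within_open[OF has_derivative_ident])
      show "open (param_dom c \<inter> torus_cube a)" by (intro open_Int open_param_dom open_torus_cube cA)
      show "\<psi> y \<in> param_dom c \<inter> torus_cube a" using W \<psi>[OF y] by blast
      show "\<theta> = (\<psi> \<circ> ?f) \<theta>" if "\<theta> \<in> param_dom c \<inter> torus_cube a" for \<theta>
      proof -
        have "angle_param \<theta> \<in> chart_dom c" using that by (simp add: param_dom_def)
        moreover have "h (angle_param \<theta>) = torus_exp \<theta>" by (simp add: angle_param_def torus_exp_in_torus)
        ultimately show ?thesis using that cA by (simp add: \<psi>_def)
      qed
    qed
    ultimately have "frechet_derivative \<psi> (at y) \<circ> frechet_derivative ?f (at (\<psi> y)) = (\<lambda>v. v)"
      by (rule has_derivative_unique)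
    then have "frechet_derivative \<psi> (at y) (frechet_derivative ?f (at (\<psi> y)) (axis i 1)) = axis i 1"
      by (simp only: fun_eq_iff comp_apply)
    then show ?thesis using angle_vfield_angle_param[OF c, of i] \<psi>[OF y] by simp
  qed
  show thesis by (rule that[OF U xU sub smooth _ D]) (simp_all add: \<psi>)
qed

text \<open>In a chart the field is the i-th partial derivative of the covering, taken at the angles
  \<psi>(y). Locally this is a composition of smooth maps.\<close>

lemma smooth_angle_vfield: "smooth_vfield M A (angle_vfield M A h i)"
  unfolding smooth_vfield_def
proof (intro conjI ballI)
  fix c assume c: "c \<in> A"
  show "smooth_on (chart_map c ` chart_dom c) (\<lambda>x. angle_vfield M A h i (chart_inv c x) c)"
  proof (rule smooth_on_local[OF open_chart_image[OF c]])
    fix x assume x: "x \<in> chart_map c ` chart_dom c"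
    obtain U \<psi> where U: "open U" "chart_map c (chart_inv c x) \<in> U" "U \<subseteq> chart_map c ` chart_dom c"
      "smooth_on U \<psi>" "\<And>y. y \<in> U \<Longrightarrow> angle_param (\<psi> y) = chart_inv c y"
      using angle_coordinates[OF charts_at_chart_inv[OF c x]] by metis
    let ?g = "\<lambda>\<theta>. frechet_derivative (chart_map c \<circ> angle_param) (at \<theta>) (axis i 1)"
    have im: "\<psi> ` U \<subseteq> param_dom c"
      using U(3,5) chart_inv_in_dom[OF c] by (auto simp: param_dom_def)
    have "smooth_on U (?g \<circ> \<psi>)"
      by (rule smooth_on_compose[OF U(1) open_param_dom[OF c] im U(4)])
        (intro smooth_on_frechet_derivative open_param_dom c smooth_on_chart_map_angle_param smooth_on_const)
    moreover have "(?g \<circ> \<psi>) y = angle_vfield M A h i (chart_inv c y) c" if "y \<in> U" for y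
      using angle_vfield_angle_param[of c "\<psi> y" i] U(3,5) that charts_at_chart_inv[OF c, of y] by auto
    ultimately have "smooth_on U (\<lambda>y. angle_vfield M A h i (chart_inv c y) c)"
      by (subst smooth_on_cong[OF U(1), symmetric])
    then show "\<exists>T. open T \<and> x \<in> T \<and> T \<subseteq> chart_map c ` chart_dom c \<and> smooth_on T (\<lambda>x. angle_vfield M A h i (chart_inv c x) c)"
      using U(1-3) c x by (intro exI[of _ U]) simp
  qed
qed (rule angle_vfield_in_tangent_space)

end

section \<open>The Laplace-Beltrami operator of a metric constant in a commuting frame\<close>

text \<open>The map taking y to the sum of the y_i e_i is a right inverse of \<open>D\<close>. A
  surjective linear endomorphism in finite dimension is injective, so it is a left inverse as
  well.\<close>

lemma frame_coordinates:
  fixes D :: "real^'m \<Rightarrow> real^'m"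
  assumes "linear D" "\<And>i. D (e i) = axis i 1"
  shows "(\<Sum>i\<in>UNIV. D b $ i *\<^sub>R e i) = b"
proof -
  have *: "D (\<Sum>i\<in>UNIV. y $ i *\<^sub>R e i) = y" for y
    using basis_expansion[of y] by (simp add: linear_sum[OF assms(1)] linear_scale[OF assms(1)] assms(2) scalar_mult_eq_scaleR)
  then have "surj D" by (rule surjI)
  then have "inj D" using assms(1) linear_surjective_imp_injective by blast
  with *[of "D b"] show ?thesis by (simp add: inj_eq)
qed

text \<open>Coordinates straightening all fields at once exist locally exactly for frames of
  commuting fields. Stating them as an axiom separates the Riemannian computation from the
  torus.\<close>

locale commuting_frame = atlas M A
  for M :: "'a::topological_space set" and A :: "('a, real^'m) chart set" +
  fixes v :: "'m \<Rightarrow> ('a, real^'m) vfield"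
  assumes smooth_frame: "smooth_vfield M A (v i)"
    and straightening: "c \<in> charts_at A p \<Longrightarrow> \<exists>U (\<psi> :: real^'m \<Rightarrow> real^'m). open U \<and> chart_map c p \<in> U \<and> U \<subseteq> chart_map c ` chart_dom c \<and>
      smooth_on U \<psi> \<and> (\<forall>i. \<forall>y\<in>U. frechet_derivative \<psi> (at y) (v i (chart_inv c y) c) = axis i 1)"
begin

lemma frame_in_tangent_space: "p \<in> M \<Longrightarrow> v i p \<in> tangent_space A p"
  using smooth_frame by (simp add: smooth_vfield_def)

lemma frame_coordinates_at:
  assumes "c \<in> charts_at A p"
  obtains D :: "real^'m \<Rightarrow> real^'m" where "linear D" "\<And>i. D (v i p c) = axis i 1"
proof -
  obtain U and \<psi> :: "real^'m \<Rightarrow> real^'m" where U: "chart_map c p \<in> U" "smooth_on U \<psi>"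
    "\<forall>i. \<forall>y\<in>U. frechet_derivative \<psi> (at y) (v i (chart_inv c y) c) = axis i 1"
    using straightening[OF assms] by blast
  show thesis
  proof
    show "linear (frechet_derivative \<psi> (at (chart_map c p)))"
      by (rule linear_frechet_derivative[OF smooth_on_imp_differentiable[OF U(2,1)]])
    show "frechet_derivative \<psi> (at (chart_map c p)) (v i p c) = axis i 1" for i
      using U(3)[rule_format, OF U(1)] assms by (simp add: charts_at_def)
  qed
qed

lemma frame_independent:
  assumes "p \<in> M" "(\<lambda>c. \<Sum>i\<in>UNIV. a i *\<^sub>R v i p c) = (\<lambda>c. 0)"
  shows "a i = 0"
proof -
  obtain D :: "real^'m \<Rightarrow> real^'m" where D: "linear D" "\<And>i. D (v i p (chart_at A p)) = axis i 1"
    using frame_coordinates_at[OF chart_at_in_charts_at[OF assms(1)]] by blast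
  have "D (\<Sum>i\<in>UNIV. a i *\<^sub>R v i p (chart_at A p)) = 0"
    using fun_cong[OF assms(2), of "chart_at A p"] linear_0[OF D(1)] by simp
  then have "(\<Sum>j\<in>UNIV. a j *\<^sub>R axis j 1 :: real^'m) = 0"
    by (simp add: linear_sum[OF D(1)] linear_scale[OF D(1)] D(2))
  moreover have "(\<Sum>j\<in>UNIV. a j *\<^sub>R axis j 1) = (\<chi> j. a j)"
    using basis_expansion[of "\<chi> j. a j"] by (simp add: scalar_mult_eq_scaleR)
  ultimately have "(\<chi> j. a j) $ i = 0" by (simp only: zero_index)
  then show ?thesis by simp
qed

end

locale dual_frame = commuting_frame M A v
  for M :: "'a::topological_space set" and A :: "('a, real^'m) chart set" and v +
  fixes \<beta> :: "'m \<Rightarrow> 'a \<Rightarrow> ('a, real^'m) tvec \<Rightarrow> real"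
  assumes one_form: "smooth_one_form M A (\<beta> i)"
    and dual: "p \<in> M \<Longrightarrow> \<beta> i p (v j p) = (if i = j then 1 else 0)"
begin

lemma one_form_linear:
  assumes "p \<in> M" "\<xi> \<in> tangent_space A p" "\<eta> \<in> tangent_space A p"
  shows "\<beta> i p (\<lambda>c. a *\<^sub>R \<xi> c + b *\<^sub>R \<eta> c) = a * \<beta> i p \<xi> + b * \<beta> i p \<eta>"
  using one_form[of i] assms unfolding smooth_one_form_def by blast

lemma one_form_frame_sum:
  assumes "p \<in> M" "finite J"
  shows "\<beta> i p (\<lambda>c. \<Sum>j\<in>J. a j *\<^sub>R v j p c) = (\<Sum>j\<in>J. a j * \<beta> i p (v j p))"
  using assms(2)
proof induction
  case empty
  \<comment> \<open>The zero vector is a combination with both coefficients 0; the index of the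
    frame vector is arbitrary.\<close>
  show ?case using one_form_linear[OF assms(1) frame_in_tangent_space frame_in_tangent_space, OF assms(1) assms(1), of i 0 undefined 0]
    by simp
next
  case (insert k J)
  have "(\<lambda>c. \<Sum>j\<in>J. a j *\<^sub>R v j p c) \<in> tangent_space A p"
    by (rule tangent_space_sum) (rule frame_in_tangent_space[OF assms(1)])
  from one_form_linear[OF assms(1) frame_in_tangent_space[OF assms(1)] this, of i "a k" k 1] insert
  show ?case by simp
qed

lemma one_form_frame_combination:
  "p \<in> M \<Longrightarrow> \<beta> i p (\<lambda>c. \<Sum>j\<in>UNIV. a j *\<^sub>R v j p c) = a i"
  by (simp add: one_form_frame_sum dual sum.delta mult_delta_right)

text \<open>The components of D(\<xi>) are the frame coefficients of \<xi>, and these are what the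
  dual form reads off. The forms, known only through duality, thereby become components of
  D\<psi>.\<close>

lemma one_form_eq_coordinate:
  fixes D :: "real^'m \<Rightarrow> real^'m"
  assumes "c \<in> charts_at A p" "\<xi> \<in> tangent_space A p" "linear D" "\<And>i. D (v i p c) = axis i 1"
  shows "\<beta> i p \<xi> = D (\<xi> c) $ i"
proof -
  have p: "p \<in> M" using charts_at_in_M[OF assms(1)] .
  have "(\<lambda>c'. \<Sum>i\<in>UNIV. D (\<xi> c) $ i *\<^sub>R v i p c') = \<xi>"
    by (rule tangent_space_eqI[OF tangent_space_sum assms(2,1)])
      (simp_all add: frame_in_tangent_space p frame_coordinates[OF assms(3,4)])
  then show ?thesis using one_form_frame_combination[OF p, of i "\<lambda>i. D (\<xi> c) $ i"] by simp
qed

lemma frame_expansion: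
  assumes "p \<in> M" "\<xi> \<in> tangent_space A p"
  shows "(\<lambda>c. \<Sum>i\<in>UNIV. \<beta> i p \<xi> *\<^sub>R v i p c) = \<xi>"
proof -
  let ?c = "chart_at A p"
  have c: "?c \<in> charts_at A p" using chart_at_in_charts_at[OF assms(1)] .
  obtain D :: "real^'m \<Rightarrow> real^'m" where D: "linear D" "\<And>i. D (v i p ?c) = axis i 1"
    using frame_coordinates_at[OF c] by blast
  show ?thesis
    by (rule tangent_space_eqI[OF tangent_space_sum assms(2) c])
      (simp_all add: frame_in_tangent_space assms(1) one_form_eq_coordinate[OF c assms(2) D] frame_coordinates[OF D])
qed

end

locale constant_frame_metric = dual_frame M A v \<beta>
  for M :: "'a::topological_space set" and A :: "('a, real^'m) chart set" and v \<beta> +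
  fixes B :: "real^'m^'m"
  assumes symmetric: "transpose B = B" and invertible: "invertible B"
begin

definition metric :: "('a, real^'m) metric" where
  "metric = (\<lambda>p \<xi> \<eta>. \<Sum>i\<in>UNIV. \<Sum>j\<in>UNIV. B $ i $ j * (\<beta> i p \<xi> * \<beta> j p \<eta>))"

text \<open>The components of df in the dual frame with the index raised by the inverse of
  \<open>B\<close>: the coefficients of the gradient in the frame.\<close>

definition gradient_coeff :: "('a \<Rightarrow> real) \<Rightarrow> 'm \<Rightarrow> 'a \<Rightarrow> real" where
  "gradient_coeff f i p = (\<Sum>j\<in>UNIV. matrix_inv B $ i $ j * vfield_apply A (v j) f p)"

lemma metric_eq: "metric p \<xi> \<eta> = (\<chi> i. \<beta> i p \<xi>) \<bullet> (B *v (\<chi> j. \<beta> j p \<eta>))"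
  by (simp add: metric_def inner_vec_def matrix_vector_mult_def sum_distrib_left mult_ac)

text \<open>Symmetry moves \<open>B\<close> to the first argument, the place of the gradient in its
  defining equation.\<close>

lemma metric_eq': "metric p \<xi> \<eta> = (B *v (\<chi> i. \<beta> i p \<xi>)) \<bullet> (\<chi> j. \<beta> j p \<eta>)"
  unfolding metric_eq by (metis dot_lmul_matrix symmetric transpose_matrix_vector)

lemma matrix_inv_mult_vector: "matrix_inv B *v (B *v x) = x" "B *v (matrix_inv B *v x) = x"
proof -
  have "B ** matrix_inv B = mat 1 \<and> matrix_inv B ** B = mat 1"
    unfolding matrix_inv_def using invertible unfolding invertible_def by (rule someI_ex)
  then show "matrix_inv B *v (B *v x) = x" "B *v (matrix_inv B *v x) = x"
    by (simp_all add: matrix_vector_mul_assoc)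
qed

text \<open>In the frame the defining equation reads B w = u, where w holds the coefficients of the
  gradient and u the derivatives of f along the frame.\<close>

lemma gradient_metric:
  assumes f: "smooth_fun M A f" and p: "p \<in> M"
  shows "gradient A metric f p = (\<lambda>c. \<Sum>i\<in>UNIV. gradient_coeff f i p *\<^sub>R v i p c)" (is "_ = ?\<xi>")
  unfolding gradient_def
proof (rule the_equality)
  define u where "u = (\<chi> j. vfield_apply A (v j) f p)"
  have w: "(\<chi> i. gradient_coeff f i p) = matrix_inv B *v u"
    by (simp add: gradient_coeff_def matrix_vector_mult_def u_def vec_eq_iff)
  have df: "tderiv A f p \<eta> = u \<bullet> (\<chi> j. \<beta> j p \<eta>)" if "\<eta> \<in> tangent_space A p" for \<eta>
  proof -
    have "tderiv A f p \<eta> = tderiv A f p (\<lambda>c. \<Sum>i\<in>UNIV. \<beta> i p \<eta> *\<^sub>R v i p c)"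
      by (simp add: frame_expansion[OF p that])
    also have "\<dots> = (\<Sum>i\<in>UNIV. \<beta> i p \<eta> *\<^sub>R tderiv A f p (v i p))"
      by (rule tderiv_sum[OF f p frame_in_tangent_space[OF p]])
    finally show ?thesis by (simp add: inner_vec_def u_def vfield_apply_def mult.commute)
  qed
  have \<xi>: "?\<xi> \<in> tangent_space A p"
    by (rule tangent_space_sum) (rule frame_in_tangent_space[OF p])
  have "(\<chi> i. \<beta> i p ?\<xi>) = matrix_inv B *v u"
    unfolding w[symmetric] by (simp add: one_form_frame_combination[OF p])
  then have "metric p ?\<xi> \<eta> = tderiv A f p \<eta>" if "\<eta> \<in> tangent_space A p" for \<eta>
    unfolding metric_eq' df[OF that] by (simp add: matrix_inv_mult_vector)
  with \<xi> show "?\<xi> \<in> tangent_space A p \<and> (\<forall>\<eta>\<in>tangent_space A p. metric p ?\<xi> \<eta> = tderiv A f p \<eta>)" by blast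
  fix \<xi> assume *: "\<xi> \<in> tangent_space A p \<and> (\<forall>\<eta>\<in>tangent_space A p. metric p \<xi> \<eta> = tderiv A f p \<eta>)"
  \<comment> \<open>Uniqueness needs only the frame vectors as test vectors.\<close>
  have "(B *v (\<chi> i. \<beta> i p \<xi>)) $ j = u $ j" for j
  proof -
    have "(\<chi> k. \<beta> k p (v j p)) = axis j 1"
      using dual[OF p] by (simp add: vec_eq_iff axis_def)
    then show ?thesis
      using *[THEN conjunct2, rule_format, OF frame_in_tangent_space[OF p, of j]]
        df[OF frame_in_tangent_space[OF p, of j]]
      by (simp add: metric_eq' inner_axis)
  qed
  then have "B *v (\<chi> i. \<beta> i p \<xi>) = u" by (simp add: vec_eq_iff)
  then have "(\<chi> i. \<beta> i p \<xi>) = (\<chi> i. gradient_coeff f i p)"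
    unfolding w using matrix_inv_mult_vector(1) by metis
  then have "\<beta> i p \<xi> = gradient_coeff f i p" for i by (simp add: vec_eq_iff)
  then show "\<xi> = ?\<xi>" using frame_expansion[OF p, of \<xi>] * by simp
qed

lemma smooth_gradient_coeff:
  assumes "smooth_fun M A f"
  shows "smooth_fun M A (gradient_coeff f i)"
  unfolding gradient_coeff_def[abs_def]
  by (intro smooth_fun_sum smooth_fun_bounded_linear[OF bounded_linear_mult_right] smooth_fun_vfield_apply smooth_frame assms)

lemma metric_det_chart:
  fixes D :: "real^'m \<Rightarrow> real^'m"
  assumes "c \<in> charts_at A q" "linear D" "\<And>i. D (v i q c) = axis i 1" "q = chart_inv c y"
  shows "metric_det A metric c y = det B * (det (matrix D))\<^sup>2"
proof -
  have "metric q (chart_vec A c q (axis i 1)) (chart_vec A c q (axis j 1))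
      = (transpose (matrix D) ** B ** matrix D) $ i $ j" for i j
  proof -
    have "\<beta> k q (chart_vec A c q b) = D b $ k" for k b
      using one_form_eq_coordinate[OF assms(1) chart_vec_in_tangent_space[OF assms(1)] assms(2,3)] assms(1)
      by simp
    then have "metric q (chart_vec A c q (axis i 1)) (chart_vec A c q (axis j 1))
      = (\<Sum>k\<in>UNIV. \<Sum>l\<in>UNIV. B $ k $ l * (D (axis i 1) $ k * D (axis j 1) $ l))"
      by (simp add: metric_def)
    also have "\<dots> = (\<Sum>l\<in>UNIV. \<Sum>k\<in>UNIV. B $ k $ l * (D (axis i 1) $ k * D (axis j 1) $ l))"
      by (rule sum.swap)
    also have "\<dots> = (transpose (matrix D) ** B ** matrix D) $ i $ j"
      by (simp add: matrix_matrix_mult_def transpose_def matrix_def sum_distrib_right sum_distrib_left mult_ac)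
    finally show ?thesis .
  qed
  then have "metric_det A metric c y = det (transpose (matrix D) ** B ** matrix D)"
    unfolding metric_det_def assms(4) by (simp add: vec_lambda_eta)
  then show ?thesis by (simp add: det_mul power2_eq_square)
qed

lemma laplace_beltrami_metric:
  assumes f: "smooth_fun M A f" and p: "p \<in> M"
  shows "laplace_beltrami A metric f p
    = - (\<Sum>i\<in>UNIV. \<Sum>j\<in>UNIV. matrix_inv B $ i $ j * vfield_apply A (v i) (vfield_apply A (v j) f) p)"
proof -
  \<comment> \<open>The chart in which \<open>divergence\<close> is evaluated at \<open>p\<close>;
    it stays fixed while the point moves through \<open>U\<close>.\<close>
  define c where "c = chart_at A p"
  define x where "x = chart_map c p"
  have c: "c \<in> charts_at A p" unfolding c_def by (rule chart_at_in_charts_at[OF p])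
  have cA: "c \<in> A" and px: "p = chart_inv c x" using c by (simp_all add: charts_at_def x_def)
  obtain U and \<psi> :: "real^'m \<Rightarrow> real^'m" where U: "open U" "x \<in> U" "U \<subseteq> chart_map c ` chart_dom c" "smooth_on U \<psi>"
    "\<forall>i. \<forall>y\<in>U. frechet_derivative \<psi> (at y) (v i (chart_inv c y) c) = axis i 1"
    using straightening[OF c] unfolding x_def by blast
  have cy: "c \<in> charts_at A (chart_inv c y)" if "y \<in> U" for y
    using charts_at_chart_inv[OF cA] U(3) that by blast
  have "smooth_on U (\<lambda>y. v i (chart_inv c y) c)" for i
    using smooth_frame[of i] cA U(3) unfolding smooth_vfield_def by (meson smooth_on_subset)
  then have v_diff: "(\<lambda>y. v i (chart_inv c y) c) differentiable (at x)" for i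
    using smooth_on_imp_differentiable U(2) by blast
  have w_diff: "(gradient_coeff f i \<circ> chart_inv c) differentiable (at x)" for i
    using smooth_fun_has_derivative[OF smooth_gradient_coeff[OF f] c] unfolding x_def differentiable_def by blast
  have "det B \<noteq> 0" using invertible invertible_det_nz by blast
  \<comment> \<open>The real \<open>sqrt\<close> is odd and multiplicative on all reals, so a
    nonzero determinant is enough here and in the factorisation \<open>det\<close>.\<close>
  then have sq: "sqrt (det B) \<noteq> 0" by simp
  have det: "sqrt (metric_det A metric c y) = sqrt (det B) * \<bar>det (matrix (frechet_derivative \<psi> (at y)))\<bar>"
    if "y \<in> U" for y
    using metric_det_chart[OF cy[OF that] linear_frechet_derivative[OF smooth_on_imp_differentiable[OF U(4) that]] _ refl] U(5) that
    by (simp add: real_sqrt_mult)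
  \<comment> \<open>The divergence differentiates the gradient, so its expression in the frame is
    required on all of \<open>U\<close> and not only at \<open>p\<close>.\<close>
  have grad: "gradient A metric f (chart_inv c y) c = (\<Sum>i\<in>UNIV. (gradient_coeff f i \<circ> chart_inv c) y *\<^sub>R v i (chart_inv c y) c)"
    if "y \<in> U" for y
    using gradient_metric[OF f charts_at_in_M[OF cy[OF that]]] by simp
  have "divergence A metric (gradient A metric f) p
    = (\<Sum>i\<in>UNIV. frechet_derivative (gradient_coeff f i \<circ> chart_inv c) (at x) (v i (chart_inv c x) c))"
    unfolding divergence_def Let_def unfolding c_def[symmetric] x_def[symmetric]
  proof (rule divergence_adapted_frame[OF U(1,2) _ v_diff _ w_diff sq det grad])
    show "C_k_on 2 U \<psi>" using U(4) unfolding smooth_on_def by blast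
    show "frechet_derivative \<psi> (at y) (v i (chart_inv c y) c) = axis i 1" if "y \<in> U" for i y
      using U(5) that by blast
  qed
  also have "\<dots> = (\<Sum>i\<in>UNIV. vfield_apply A (v i) (gradient_coeff f i) p)"
    unfolding px[symmetric] unfolding x_def
    by (intro sum.cong[OF refl], rule vfield_apply_chart[OF smooth_gradient_coeff[OF f] c, symmetric])
      (rule frame_in_tangent_space[OF p])
  also have "\<dots> = (\<Sum>i\<in>UNIV. \<Sum>j\<in>UNIV. matrix_inv B $ i $ j * vfield_apply A (v i) (vfield_apply A (v j) f) p)"
  proof (rule sum.cong[OF refl])
    fix i
    have s: "smooth_fun M A (vfield_apply A (v j) f)" for j
      by (rule smooth_fun_vfield_apply[OF smooth_frame f])
    have "vfield_apply A (v i) (gradient_coeff f i) p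
      = (\<Sum>j\<in>UNIV. vfield_apply A (v i) (\<lambda>q. matrix_inv B $ i $ j * vfield_apply A (v j) f q) p)"
      unfolding gradient_coeff_def[abs_def]
      by (intro vfield_apply_sum smooth_fun_bounded_linear[OF bounded_linear_mult_right] s p)
    also have "\<dots> = (\<Sum>j\<in>UNIV. matrix_inv B $ i $ j * vfield_apply A (v i) (vfield_apply A (v j) f) p)"
      by (intro sum.cong refl vfield_apply_bounded_linear[OF bounded_linear_mult_right s p])
    finally show "vfield_apply A (v i) (gradient_coeff f i) p
      = (\<Sum>j\<in>UNIV. matrix_inv B $ i $ j * vfield_apply A (v i) (vfield_apply A (v j) f) p)" .
  qed
  finally show ?thesis by (simp add: laplace_beltrami_def)
qed

text \<open>\<open>laplace_beltrami\<close> selects a chart at each point, so smoothness is taken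
  from the right-hand side of the formula.\<close>

lemma smooth_laplace_beltrami_metric:
  assumes f: "smooth_fun M A f"
  shows "smooth_fun M A (laplace_beltrami A metric f)"
proof -
  have "smooth_fun M A (\<lambda>p. - (\<Sum>i\<in>UNIV. \<Sum>j\<in>UNIV. matrix_inv B $ i $ j * vfield_apply A (v i) (vfield_apply A (v j) f) p))"
    by (intro smooth_fun_bounded_linear[OF bounded_linear_minus[OF bounded_linear_ident]] smooth_fun_sum
        smooth_fun_bounded_linear[OF bounded_linear_mult_right] smooth_fun_vfield_apply smooth_frame f)
  then show ?thesis
    by (subst smooth_fun_cong[OF laplace_beltrami_metric[OF f]])
qed

lemma vfield_apply_twice_bounded_linear:
  assumes "bounded_linear L" "smooth_fun M A f" "p \<in> M"
  shows "vfield_apply A (v i) (vfield_apply A (v j) (\<lambda>q. L (f q))) p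
    = L (vfield_apply A (v i) (vfield_apply A (v j) f) p)"
proof -
  have "vfield_apply A (v i) (vfield_apply A (v j) (\<lambda>q. L (f q))) p
      = vfield_apply A (v i) (\<lambda>q. L (vfield_apply A (v j) f q)) p"
    by (rule vfield_apply_cong[OF vfield_apply_bounded_linear[OF assms(1,2)] assms(3)])
  also have "\<dots> = L (vfield_apply A (v i) (vfield_apply A (v j) f) p)"
    by (rule vfield_apply_bounded_linear[OF assms(1) smooth_fun_vfield_apply[OF smooth_frame assms(2)] assms(3)])
  finally show ?thesis .
qed

text \<open>The real formula for \<open>Re\<close> and \<open>Im\<close> of f; both are bounded
  linear and commute with the vector fields.\<close>

lemma laplace_beltrami_complex_metric:
  assumes f: "smooth_fun M A f" and p: "p \<in> M"
  shows "laplace_beltrami_complex A metric f p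
    = - (\<Sum>i\<in>UNIV. \<Sum>j\<in>UNIV. of_real (matrix_inv B $ i $ j) * vfield_apply A (v i) (vfield_apply A (v j) f) p)"
proof -
  have "laplace_beltrami A metric (\<lambda>q. L (f q)) p
    = - (\<Sum>i\<in>UNIV. \<Sum>j\<in>UNIV. matrix_inv B $ i $ j * L (vfield_apply A (v i) (vfield_apply A (v j) f) p))"
    if L: "bounded_linear L" for L
    by (simp only: laplace_beltrami_metric[OF smooth_fun_bounded_linear[OF L f] p]
        vfield_apply_twice_bounded_linear[OF L f p])
  from this[OF bounded_linear_Re] this[OF bounded_linear_Im] show ?thesis
    by (simp add: laplace_beltrami_complex_def complex_eq_iff)
qed

lemma smooth_laplace_beltrami_complex_metric:
  assumes f: "smooth_fun M A f"
  shows "smooth_fun M A (laplace_beltrami_complex A metric f)"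
proof -
  have "smooth_fun M A (\<lambda>p. - (\<Sum>i\<in>UNIV. \<Sum>j\<in>UNIV. of_real (matrix_inv B $ i $ j) * vfield_apply A (v i) (vfield_apply A (v j) f) p))"
    by (intro smooth_fun_bounded_linear[OF bounded_linear_minus[OF bounded_linear_ident]] smooth_fun_sum
        smooth_fun_bounded_linear[OF bounded_linear_mult_right] smooth_fun_vfield_apply smooth_frame f)
  then show ?thesis
    by (subst smooth_fun_cong[OF laplace_beltrami_complex_metric[OF f]])
qed

end

section \<open>Invertibility of the averaged metric\<close>

text \<open>Tested with the rational coefficients 1 at \<open>i\<close> and 0 elsewhere. It allows
  the angles to be divided by the frequencies.\<close>

lemma rationally_independent_nonzero:
  assumes "rationally_independent \<Omega>"
  shows "\<Omega> i \<noteq> 0"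
proof
  assume "\<Omega> i = 0"
  have "(\<Sum>j\<in>UNIV. of_rat (if j = i then 1 else 0) * \<Omega> j) = (\<Sum>j\<in>UNIV. if j = i then \<Omega> j else 0)"
    by (intro sum.cong) auto
  also have "\<dots> = 0" using \<open>\<Omega> i = 0\<close> by simp
  finally have "\<forall>j. (if j = i then 1 else 0 :: rat) = 0"
    by (rule assms[unfolded rationally_independent_def, THEN spec, THEN mp])
  from spec[OF this, of i] show False by simp
qed

lemma (in atlas) smooth_vfield_scaleR:
  assumes "smooth_vfield M A X"
  shows "smooth_vfield M A (\<lambda>p c. a *\<^sub>R X p c)"
  unfolding smooth_vfield_def
proof (intro conjI ballI)
  show "(\<lambda>c. a *\<^sub>R X p c) \<in> tangent_space A p" if "p \<in> M" for p
    using tangent_space_sum[of "{0 :: nat}" "\<lambda>_. X p" p "\<lambda>_. a"] assms that by (simp add: smooth_vfield_def)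
  show "smooth_on (chart_map c ` chart_dom c) (\<lambda>x. a *\<^sub>R X (chart_inv c x) c)" if "c \<in> A" for c
    using assms that
    by (intro smooth_on_bounded_linear[OF open_chart_image bounded_linear_scaleR_right])
      (auto simp: smooth_vfield_def)
qed

lemma (in torus_diffeo) commuting_frame_scaled_angle_vfields:
  fixes \<Omega> :: "'m \<Rightarrow> real"
  assumes "\<And>i. \<Omega> i \<noteq> 0"
  shows "commuting_frame M A (\<lambda>i p c. \<Omega> i *\<^sub>R angle_vfield M A h i p c)"
proof
  show "smooth_vfield M A (\<lambda>p c. \<Omega> i *\<^sub>R angle_vfield M A h i p c)" for i
    by (rule smooth_vfield_scaleR[OF smooth_angle_vfield])
  fix c p assume "c \<in> charts_at A p"
  from angle_coordinates[OF this] obtain U and \<psi> :: "real^'m \<Rightarrow> real^'m"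
    where U: "open U" "chart_map c p \<in> U" "U \<subseteq> chart_map c ` chart_dom c" "smooth_on U \<psi>"
      and D: "\<And>i y. y \<in> U \<Longrightarrow> frechet_derivative \<psi> (at y) (angle_vfield M A h i (chart_inv c y) c) = axis i 1"
    by metis
  define L where "L w = (\<chi> k. w $ k / \<Omega> k)" for w :: "real^'m"
  have L: "bounded_linear L"
    unfolding linear_conv_bounded_linear[symmetric]
    by (rule linearI) (simp_all add: L_def vec_eq_iff add_divide_distrib)
  have "frechet_derivative (\<lambda>y. L (\<psi> y)) (at y) (\<Omega> i *\<^sub>R angle_vfield M A h i (chart_inv c y) c) = axis i 1"
    if "y \<in> U" for i y
  proof -
    have d: "\<psi> differentiable (at y)" by (rule smooth_on_imp_differentiable[OF U(4) that])
    have "frechet_derivative (\<lambda>y. L (\<psi> y)) (at y) (\<Omega> i *\<^sub>R angle_vfield M A h i (chart_inv c y) c)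
      = L (\<Omega> i *\<^sub>R axis i 1)"
      unfolding frechet_derivative_bounded_linear[OF L d] linear_scale[OF linear_frechet_derivative[OF d]] D[OF that] ..
    also have "\<dots> = axis i 1" using assms by (simp add: L_def vec_eq_iff axis_def)
    finally show ?thesis .
  qed
  moreover have "smooth_on U (\<lambda>y. L (\<psi> y))" by (rule smooth_on_bounded_linear[OF U(1) L U(4)])
  ultimately show "\<exists>U (\<psi> :: real^'m \<Rightarrow> real^'m). open U \<and> chart_map c p \<in> U \<and> U \<subseteq> chart_map c ` chart_dom c \<and> smooth_on U \<psi> \<and>
      (\<forall>i. \<forall>y\<in>U. frechet_derivative \<psi> (at y) (\<Omega> i *\<^sub>R angle_vfield M A h i (chart_inv c y) c) = axis i 1)"
    using U(1-3) by (intro exI[of _ U] exI[of _ "\<lambda>y. L (\<psi> y)"]) simp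
qed

lemma integrable_continuous_on_compact:
  fixes f :: "'a::topological_space \<Rightarrow> real"
  assumes "finite_measure \<mu>" "space \<mu> = M" "sets \<mu> = sets (restrict_space borel M)" "compact M" "continuous_on M f"
  shows "integrable \<mu> f"
proof -
  have "bounded (f ` M)" using assms(4,5) compact_continuous_image compact_imp_bounded by blast
  then obtain K where "\<And>x. x \<in> M \<Longrightarrow> norm (f x) \<le> K" by (auto simp: bounded_iff)
  then have "AE x in \<mu>. norm (f x) \<le> K" using assms(2) by auto
  moreover have "f \<in> borel_measurable \<mu>"
    using borel_measurable_continuous_on_restrict[OF assms(5)] measurable_cong_sets[OF assms(3) refl] by blast
  ultimately show ?thesis using finite_measure.integrable_const_bound[OF assms(1)] by blast
qed

text \<open>For \<open>w\<close> in the kernel, 0 = w.Bw is the integral of |dF(\<Sum> w_i v_i)|^2.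
  If \<open>w\<close> were nonzero, the integrand would be positive at every point of
  \<open>M\<close>.\<close>

lemma (in commuting_frame) invertible_mean_metric:
  fixes F :: "'a \<Rightarrow> 'd::euclidean_space"
  assumes "prob_space \<mu>" "space \<mu> = M" "sets \<mu> = sets (restrict_space borel M)" "compact M"
    and F: "smooth_embedding M A F"
  shows "invertible (\<chi> i j. LINT p|\<mu>. induced_metric A F p (v i p) (v j p))" (is "invertible ?B")
proof -
  interpret prob_space \<mu> by fact
  define \<phi> where "\<phi> i = vfield_apply A (v i) F" for i
  have F_smooth: "smooth_fun M A F" using F by (simp add: smooth_embedding_def)
  have \<phi>: "continuous_on M (\<phi> i)" for i
    using smooth_fun_vfield_apply[OF smooth_frame F_smooth, of i] by (simp add: \<phi>_def smooth_fun_def smooth_map_def)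
  have int: "integrable \<mu> (\<lambda>p. \<phi> i p \<bullet> \<phi> j p)" for i j
    by (rule integrable_continuous_on_compact[OF finite_measure_axioms assms(2-4)]) (intro continuous_intros \<phi>)
  have "w = 0" if w: "?B *v w = 0" for w
  proof (rule ccontr)
    assume "w \<noteq> 0"
    define s where "s p = (\<Sum>i\<in>UNIV. w $ i *\<^sub>R \<phi> i p)" for p
    have s_nz: "s p \<noteq> 0" if p: "p \<in> M" for p
    proof
      assume "s p = 0"
      let ?\<xi> = "\<lambda>c. \<Sum>i\<in>UNIV. w $ i *\<^sub>R v i p c"
      have "tderiv A F p ?\<xi> = s p"
        using tderiv_sum[OF F_smooth p frame_in_tangent_space[OF p]] by (simp add: s_def \<phi>_def vfield_apply_def)
      \<comment> \<open>The zero tangent vector is the empty sum; injectivity of the derivative of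
        \<open>F\<close> is then applied to it and \<open>?\<xi>\<close>.\<close>
      also have "\<dots> = tderiv A F p (\<lambda>c. 0)"
        using tderiv_sum[OF F_smooth p, of "{} :: 'm set" "\<lambda>i. v i p" "\<lambda>_. 0"] \<open>s p = 0\<close> by simp
      finally have "?\<xi> = (\<lambda>c. 0)"
        using F p tangent_space_sum[of UNIV "\<lambda>i. v i p" p "\<lambda>i. w $ i"]
          tangent_space_sum[of "{} :: 'm set" "\<lambda>i. v i p" p "\<lambda>_. 0"] frame_in_tangent_space[OF p]
        by (auto simp: smooth_embedding_def inj_on_def)
      then have "w $ i = 0" for i by (rule frame_independent[OF p])
      with \<open>w \<noteq> 0\<close> show False by (simp add: vec_eq_iff)
    qed
    have "0 = w \<bullet> (?B *v w)" by (simp add: w)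
    also have "\<dots> = (\<Sum>i\<in>UNIV. \<Sum>j\<in>UNIV. LINT p|\<mu>. w $ i * w $ j * (\<phi> i p \<bullet> \<phi> j p))"
      by (simp add: inner_vec_def matrix_vector_mult_def induced_metric_def \<phi>_def vfield_apply_def sum_distrib_left mult_ac)
    also have "\<dots> = (LINT p|\<mu>. (\<Sum>i\<in>UNIV. \<Sum>j\<in>UNIV. w $ i * w $ j * (\<phi> i p \<bullet> \<phi> j p)))"
      by (simp add: Bochner_Integration.integral_sum int)
    also have "\<dots> = (LINT p|\<mu>. s p \<bullet> s p)"
      by (simp add: s_def inner_sum_left inner_sum_right sum_distrib_left mult_ac inner_commute)
    finally have "(LINT p|\<mu>. s p \<bullet> s p) = 0" by simp
    moreover have "integrable \<mu> (\<lambda>p. s p \<bullet> s p)"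
      by (simp add: s_def inner_sum_left inner_sum_right int)
    ultimately have "AE p in \<mu>. s p \<bullet> s p = 0"
      by (subst (asm) integral_nonneg_eq_0_iff_AE) auto
    \<comment> \<open>The integrand would vanish almost everywhere although it vanishes nowhere,
      which a probability measure excludes.\<close>
    then have "AE p in \<mu>. False"
      using AE_space by eventually_elim (use s_nz assms(2) in auto)
    then show False by simp
  qed
  then show ?thesis
    unfolding invertible_left_inverse matrix_left_invertible_ker by blast
qed

theorem lemma18:
  fixes M :: "'a::topological_space set"
    and A :: "('a, real^'m) chart set"
    and \<mu> :: "'a measure"
    and \<Phi> :: "real \<Rightarrow> 'a \<Rightarrow> 'a"
    and V :: "('a, real^'m) vfield"
    and T :: real
    and \<Omega> :: "'m \<Rightarrow> real"
    and \<zeta> :: "'m \<Rightarrow> 'a \<Rightarrow> complex"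
    and v :: "'m \<Rightarrow> ('a, real^'m) vfield"
    and F :: "'a \<Rightarrow> real^'d"
    and g gbar :: "('a, real^'m) metric"
    and B :: "real^'m^'m"
    and \<beta> :: "'m \<Rightarrow> 'a \<Rightarrow> ('a, real^'m) tvec \<Rightarrow> real"
  assumes "smooth_manifold M A" and "compact M" and "connected M" and "orientable M A"
    and "smooth_flow M A \<Phi>" and "flow_generator M A \<Phi> V"
    and "prob_space \<mu>" and "space \<mu> = M" and "sets \<mu> = sets (restrict_space borel M)"
    and "smooth_positive_density M A \<mu>"
    and "flow_invariant \<mu> \<Phi>"
    and "T > 0" and "discrete_time_ergodic \<mu> \<Phi> T"
    and "pure_point_spectrum M A \<mu> \<Phi> \<Omega> \<zeta>"
    and "v = (\<lambda>i p c. \<Omega> i *\<^sub>R angle_vfield M A (\<lambda>p. \<chi> j. \<zeta> j p) i p c)"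
    and "smooth_embedding M A F" and "g = induced_metric A F"
    and "B = (\<chi> i j. LINT p|\<mu>. g p (v i p) (v j p))"
    and "\<And>i. smooth_one_form M A (\<beta> i)"
    and "\<And>i j p. p \<in> M \<Longrightarrow> \<beta> i p (v j p) = (if i = j then 1 else 0)"
    and "gbar = (\<lambda>p \<xi> \<eta>. \<Sum>i\<in>UNIV. \<Sum>j\<in>UNIV. B $ i $ j * (\<beta> i p \<xi> * \<beta> j p \<eta>))"
  shows "invertible B \<and>
    (\<forall>f :: 'a \<Rightarrow> real. smooth_fun M A f \<longrightarrow>
       smooth_fun M A (laplace_beltrami A gbar f) \<and>
       (\<forall>p\<in>M. laplace_beltrami A gbar f p =
          - (\<Sum>i\<in>UNIV. \<Sum>j\<in>UNIV. matrix_inv B $ i $ j * vfield_apply A (v i) (vfield_apply A (v j) f) p))) \<and>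
    (\<forall>f :: 'a \<Rightarrow> complex. smooth_fun M A f \<longrightarrow>
       smooth_fun M A (laplace_beltrami_complex A gbar f) \<and>
       (\<forall>p\<in>M. laplace_beltrami_complex A gbar f p =
          - (\<Sum>i\<in>UNIV. \<Sum>j\<in>UNIV. of_real (matrix_inv B $ i $ j) * vfield_apply A (v i) (vfield_apply A (v j) f) p)))"
proof -
  define h where "h = (\<lambda>p. \<chi> j. \<zeta> j p)"
  have "smooth_atlas M A" using assms(1) by (simp add: smooth_manifold_def)
  moreover have "diffeomorphism M A torus torus_atlas h" "rationally_independent \<Omega>"
    using assms(14) by (auto simp: pure_point_spectrum_def h_def)
  ultimately interpret torus_diffeo M A h by unfold_locales
  have v: "v = (\<lambda>i p c. \<Omega> i *\<^sub>R angle_vfield M A h i p c)"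
    unfolding assms(15) h_def ..
  \<comment> \<open>Rational independence is used here, to make all frequencies nonzero.\<close>
  interpret commuting_frame M A v
    unfolding v
    by (rule commuting_frame_scaled_angle_vfields)
      (rule rationally_independent_nonzero[OF \<open>rationally_independent \<Omega>\<close>])
  interpret dual_frame M A v \<beta>
    using assms(19,20) by unfold_locales
  have inv: "invertible B"
    unfolding assms(17,18) by (rule invertible_mean_metric[OF assms(7-9) assms(2) assms(16)])
  interpret constant_frame_metric M A v \<beta> B
  proof
    show "transpose B = B"
      by (simp add: assms(17,18) transpose_def vec_eq_iff induced_metric_def inner_commute)
  qed (rule inv)
  have "gbar = metric" unfolding assms(21) metric_def ..
  then show ?thesis
    using inv laplace_beltrami_metric smooth_laplace_beltrami_metric
      laplace_beltrami_complex_metric smooth_laplace_beltrami_complex_metric by simp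
qed

end
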